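(* Let $\mu\in(0,1)$ and $r>0$, let $S_{\mu,r}$ be the pseudospherical helicoid (of electric type) with parameters $(\mu,r)$, and put $m=\mu^{-1}>1$. Define $$\psi(u)=-\frac{\sqrt{m+\sinh^2 r}\,\coth(r)}{\sqrt m}\,\Pi\Big(-\mathrm{csch}^2 r,\ \mathrm{am}\big(\sqrt m\,u,\tfrac1m\big),\ \tfrac1m\Big),$$ $$\zeta(u)=\frac{(\cosh^2 r+m-1)\,u-\sqrt m\,E\big(\mathrm{am}(\sqrt m\,u,\tfrac1m),\tfrac1m\big)}{\sqrt{m+\sinh^2 r}},\qquad \xi(u)=\sqrt{\frac{m}{m\,\mathrm{sn}^2(u,m)+\sinh^2 r}},$$ $$q^1(u)=\frac{\cosh(r)\sinh(r)}{m+\sinh^2 r}\,\mathrm{cn}(u,m),\qquad q^2(u)=\frac{\mathrm{dn}(u,m)\,\mathrm{sn}(u,m)}{\sqrt{m+\sinh^2 r}},\qquad \rho=-2\pi\frac{\cosh(r)\sinh(r)}{m+\sinh^2 r},$$ and $$\widetilde x=\xi\big(\cos(\psi)q^1-\sin(\psi)q^2\big),\qquad \widetilde y=\xi\big(\sin(\psi)q^1+\cos(\psi)q^2\big),\qquad \widetilde z=\zeta .$$ Then the real analytic map $\widetilde f:\mathbb{R}^2\to\mathbb{R}^3$, $$\widetilde f(u,v)=\big(\cos(2\pi v)\widetilde x(u)-\sin(2\pi v)\widetilde y(u),\ \sin(2\pi v)\widetilde x(u)+\cos(2\pi v)\widetilde y(u),\ \widetilde z(u)+\rho v\big),$$ is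 a global parametrization of $-S_{\mu,r}=\{-\mathbf{x}:\mathbf{x}\in S_{\mu,r}\}$.
   Context: Elliptic functions and integrals (parameter $m=k^2$). $F(\varphi,m)=\int_0^\varphi(1-m\sin^2\theta)^{-1/2}d\theta$, $E(\varphi,m)=\int_0^\varphi(1-m\sin^2\theta)^{1/2}d\theta$, $\Pi(n,\varphi,m)=\int_0^\varphi\frac{d\theta}{(1-n\sin^2\theta)(1-m\sin^2\theta)^{1/2}}$. For any real $\mu$, $\mathrm{am}(\cdot,\mu):\mathbb{R}\to\mathbb{R}$ is the Jacobian amplitude, i.e. the solution of $\theta''=-\mu\sin\theta\cos\theta$, $\theta(0)=0$, $\theta'(0)=1$ (near $0$, the inverse of $F(\cdot,\mu)$), and $\mathrm{sn}=\sin\mathrm{am}$, $\mathrm{cn}=\cos\mathrm{am}$, $\mathrm{dn}=\mathrm{am}'$ (so $\mathrm{dn}^2=1-\mu\,\mathrm{sn}^2$). In particular, for $m>1$: $\mathrm{sn}(u,m)=\tfrac{1}{\sqrt m}\mathrm{sn}(\sqrt m\,u,\tfrac1m)$, $\mathrm{cn}(u,m)=\mathrm{dn}(\sqrt m\,u,\tfrac1m)$, $\mathrm{dn}(u,m)=\mathrm{cn}(\sqrt m\,u,\tfrac1m)$. Pseudospherical helicoids. Let $\phi:\mathbb{R}^2\to\mathbb{R}$ be a smooth nonconstant solution of the sine-Gordon equation $\phi_{ss}-\phi_{tt}=\sin\phi$. There is a smooth map $f_\phi:\mathbb{R}^2\to\mathbb{R}^3$, unique up to orientation-preserving rigid motions,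 which on the open set where $\phi\notin\pi\mathbb{Z}$ is an immersion of Gauss curvature $-1$ with first and second fundamental forms $\cos^2(\phi/2)ds^2+\sin^2(\phi/2)dt^2$ and $\cos(\phi/2)\sin(\phi/2)(ds^2-dt^2)$; precisely, there is a smooth positively oriented orthonormal frame $(e_1,e_2,e_3)$ along $f_\phi$ with $\partial_s f_\phi=\cos(\phi/2)e_1$, $\partial_t f_\phi=\sin(\phi/2)e_2$, and the second fundamental form is $-\langle df_\phi,de_3\rangle$. For $\mu>0$, $\mu\neq1$ and $r>0$ put $\phi_{\mu,r}(s,t)=-2\,\mathrm{am}\big(\tfrac{\sinh r}{\sqrt{\mu}}s+\tfrac{\cosh r}{\sqrt{\mu}}t,\mu\big)$, a solution of the sine-Gordon equation. The pseudospherical helicoid with parameters $(\mu,r)$ is the image $S_{\mu,r}=f_{\phi_{\mu,r}}(\mathbb{R}^2)$; it is defined up to orientation-preserving rigid motions. A global parametrization of a surface $S$ is a map defined on all of $\mathbb{R}^2$ whose image is $S$; equality of surfaces is understood up to orientation-preserving rigid motions. *)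

theory Defs
  imports "HOL-Analysis.Analysis"
begin

text \<open>All elliptic functions take the parameter \<open>m = k\<^sup>2\<close>, not the modulus. The interval
  integral is oriented, so negative amplitudes are covered.\<close>

definition ellint_E :: "real \<Rightarrow> real \<Rightarrow> real" where
  "ellint_E \<phi> m = (LBINT \<theta>=0..ereal \<phi>. sqrt (1 - m * (sin \<theta>)\<^sup>2))"

definition ellint_Pi :: "real \<Rightarrow> real \<Rightarrow> real \<Rightarrow> real" where
  "ellint_Pi n \<phi> m =
     (LBINT \<theta>=0..ereal \<phi>. 1 / ((1 - n * (sin \<theta>)\<^sup>2) * sqrt (1 - m * (sin \<theta>)\<^sup>2)))"

definition is_jacobi_am :: "real \<Rightarrow> (real \<Rightarrow> real) \<Rightarrow> bool" where
  "is_jacobi_am \<mu> \<theta> \<longleftrightarrow>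
     (\<exists>\<theta>'. (\<forall>u. (\<theta> has_real_derivative \<theta>' u) (at u)) \<and>
           (\<forall>u. (\<theta>' has_real_derivative - \<mu> * sin (\<theta> u) * cos (\<theta> u)) (at u)) \<and>
           \<theta> 0 = 0 \<and> \<theta>' 0 = 1)"

text \<open>The right-hand side of the differential equation is globally Lipschitz in \<open>\<theta>\<close>, so the
  solution exists on the whole line and is unique, for every real \<open>\<mu>\<close>.\<close>

definition jacobi_am :: "real \<Rightarrow> real \<Rightarrow> real" where
  "jacobi_am u \<mu> = (THE \<theta>. is_jacobi_am \<mu> \<theta>) u"

definition jacobi_sn :: "real \<Rightarrow> real \<Rightarrow> real" where
  "jacobi_sn u \<mu> = sin (jacobi_am u \<mu>)"

definition jacobi_cn :: "real \<Rightarrow> real \<Rightarrow> real" where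
  "jacobi_cn u \<mu> = cos (jacobi_am u \<mu>)"

text \<open>For \<open>\<mu> > 1\<close> this takes negative values, unlike \<open>sqrt (1 - \<mu> * sn\<^sup>2)\<close>.\<close>

definition jacobi_dn :: "real \<Rightarrow> real \<Rightarrow> real" where
  "jacobi_dn u \<mu> = deriv (\<lambda>w. jacobi_am w \<mu>) u"

primrec C_k :: "nat \<Rightarrow> ('a::euclidean_space \<Rightarrow> 'b::euclidean_space) \<Rightarrow> bool" where
  "C_k 0 f \<longleftrightarrow> continuous_on UNIV f"
| "C_k (Suc k) f \<longleftrightarrow>
     (\<forall>p. f differentiable (at p)) \<and> (\<forall>v. C_k k (\<lambda>p. frechet_derivative f (at p) v))"

definition smooth :: "('a::euclidean_space \<Rightarrow> 'b::euclidean_space) \<Rightarrow> bool" where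
  "smooth f \<longleftrightarrow> (\<forall>k. C_k k f)"

text \<open>Real analyticity on the plane: near every point, the map is the sum of a convergent
  double power series.\<close>

definition real_analytic :: "(real \<times> real \<Rightarrow> 'b::euclidean_space) \<Rightarrow> bool" where
  "real_analytic f \<longleftrightarrow>
     (\<forall>a b. \<exists>c :: nat \<times> nat \<Rightarrow> 'b. \<exists>\<epsilon>>0. \<forall>x y. \<bar>x - a\<bar> < \<epsilon> \<longrightarrow> \<bar>y - b\<bar> < \<epsilon> \<longrightarrow>
        ((\<lambda>(i, j). ((x - a) ^ i * (y - b) ^ j) *\<^sub>R c (i, j)) has_sum f (x, y)) UNIV)"

definition rigidly_congruent :: "(real ^ 3) set \<Rightarrow> (real ^ 3) set \<Rightarrow> bool" where
  "rigidly_congruent S T \<longleftrightarrow>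
     (\<exists>A b. rotation_matrix A \<and> T = (\<lambda>x. A *v x + b) ` S)"

definition global_parametrization :: "(real \<times> real \<Rightarrow> real ^ 3) \<Rightarrow> (real ^ 3) set \<Rightarrow> bool" where
  "global_parametrization f S \<longleftrightarrow> rigidly_congruent S (range f)"

definition oriented_orthonormal :: "real ^ 3 \<Rightarrow> real ^ 3 \<Rightarrow> real ^ 3 \<Rightarrow> bool" where
  "oriented_orthonormal a b c \<longleftrightarrow>
     norm a = 1 \<and> norm b = 1 \<and> norm c = 1 \<and>
     inner a b = 0 \<and> inner a c = 0 \<and> inner b c = 0 \<and>
     det (vector [a, b, c] :: real ^ 3 ^ 3) > 0"

text \<open>\<open>f\<close> is a pseudospherical map with angle function \<open>\<phi>\<close>. The two conditions on the
  directional derivatives along \<open>(1, 0) = \<partial>\<^sub>s\<close> and \<open>(0, 1) = \<partial>\<^sub>t\<close> say that the first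
  fundamental form is \<open>cos\<^sup>2(\<phi>/2) ds\<^sup>2 + sin\<^sup>2(\<phi>/2) dt\<^sup>2\<close>, so that \<open>f\<close> is an immersion where
  \<open>\<phi> \<notin> \<pi>\<int>\<close>; the last condition says that there the second fundamental form
  \<open>- \<langle>df, de\<^sub>3\<rangle>\<close> is \<open>cos(\<phi>/2) sin(\<phi>/2) (ds\<^sup>2 - dt\<^sup>2)\<close>. The ratio of the determinants
  of the two forms, the Gauss curvature, is therefore \<open>-1\<close>.\<close>

definition is_pseudospherical_map ::
    "(real \<times> real \<Rightarrow> real) \<Rightarrow> (real \<times> real \<Rightarrow> real ^ 3) \<Rightarrow> bool" where
  "is_pseudospherical_map \<phi> f \<longleftrightarrow> smooth f \<and>
     (\<exists>e1 e2 e3. smooth e1 \<and> smooth e2 \<and> smooth e3 \<and>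
        (\<forall>p. oriented_orthonormal (e1 p) (e2 p) (e3 p)) \<and>
        (\<forall>p. frechet_derivative f (at p) (1, 0) = cos (\<phi> p / 2) *\<^sub>R e1 p) \<and>
        (\<forall>p. frechet_derivative f (at p) (0, 1) = sin (\<phi> p / 2) *\<^sub>R e2 p) \<and>
        (\<forall>p. (\<forall>k::int. \<phi> p \<noteq> of_int k * pi) \<longrightarrow>
           (\<forall>a b. - inner (frechet_derivative f (at p) (a, b)) (frechet_derivative e3 (at p) (a, b))
                  = cos (\<phi> p / 2) * sin (\<phi> p / 2) * (a\<^sup>2 - b\<^sup>2))))"

text \<open>The map attached to a solution of the sine-Gordon equation
  \<open>\<phi>\<^sub>s\<^sub>s - \<phi>\<^sub>t\<^sub>t = sin \<phi>\<close> is determined only up to an orientation-preserving rigid motion;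
  an arbitrary representative is selected.\<close>

definition pseudospherical_map :: "(real \<times> real \<Rightarrow> real) \<Rightarrow> real \<times> real \<Rightarrow> real ^ 3" where
  "pseudospherical_map \<phi> = (SOME f. is_pseudospherical_map \<phi> f)"

definition helicoid_angle :: "real \<Rightarrow> real \<Rightarrow> real \<times> real \<Rightarrow> real" where
  "helicoid_angle \<mu> r =
     (\<lambda>(s, t). - 2 * jacobi_am (sinh r / sqrt \<mu> * s + cosh r / sqrt \<mu> * t) \<mu>)"

definition pseudospherical_helicoid :: "real \<Rightarrow> real \<Rightarrow> (real ^ 3) set" where
  "pseudospherical_helicoid \<mu> r = range (pseudospherical_map (helicoid_angle \<mu> r))"

definition helicoid_psi :: "real \<Rightarrow> real \<Rightarrow> real \<Rightarrow> real" where
  "helicoid_psi m r u =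
     - (sqrt (m + (sinh r)\<^sup>2) * (cosh r / sinh r) / sqrt m) *
       ellint_Pi (- (1 / sinh r)\<^sup>2) (jacobi_am (sqrt m * u) (1 / m)) (1 / m)"

definition helicoid_zeta :: "real \<Rightarrow> real \<Rightarrow> real \<Rightarrow> real" where
  "helicoid_zeta m r u =
     (((cosh r)\<^sup>2 + m - 1) * u - sqrt m * ellint_E (jacobi_am (sqrt m * u) (1 / m)) (1 / m)) /
     sqrt (m + (sinh r)\<^sup>2)"

definition helicoid_xi :: "real \<Rightarrow> real \<Rightarrow> real \<Rightarrow> real" where
  "helicoid_xi m r u = sqrt (m / (m * (jacobi_sn u m)\<^sup>2 + (sinh r)\<^sup>2))"

definition helicoid_q1 :: "real \<Rightarrow> real \<Rightarrow> real \<Rightarrow> real" where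
  "helicoid_q1 m r u = cosh r * sinh r / (m + (sinh r)\<^sup>2) * jacobi_cn u m"

definition helicoid_q2 :: "real \<Rightarrow> real \<Rightarrow> real \<Rightarrow> real" where
  "helicoid_q2 m r u = jacobi_dn u m * jacobi_sn u m / sqrt (m + (sinh r)\<^sup>2)"

definition helicoid_rho :: "real \<Rightarrow> real \<Rightarrow> real" where
  "helicoid_rho m r = - 2 * pi * (cosh r * sinh r / (m + (sinh r)\<^sup>2))"

definition helicoid_x :: "real \<Rightarrow> real \<Rightarrow> real \<Rightarrow> real" where
  "helicoid_x m r u = helicoid_xi m r u *
     (cos (helicoid_psi m r u) * helicoid_q1 m r u - sin (helicoid_psi m r u) * helicoid_q2 m r u)"

definition helicoid_y :: "real \<Rightarrow> real \<Rightarrow> real \<Rightarrow> real" where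
  "helicoid_y m r u = helicoid_xi m r u *
     (sin (helicoid_psi m r u) * helicoid_q1 m r u + cos (helicoid_psi m r u) * helicoid_q2 m r u)"

definition helicoid_param :: "real \<Rightarrow> real \<Rightarrow> real \<times> real \<Rightarrow> real ^ 3" where
  "helicoid_param m r = (\<lambda>(u, v). vector
     [cos (2 * pi * v) * helicoid_x m r u - sin (2 * pi * v) * helicoid_y m r u,
      sin (2 * pi * v) * helicoid_x m r u + cos (2 * pi * v) * helicoid_y m r u,
      helicoid_zeta m r u + helicoid_rho m r * v])"

end

theory Submission
  imports Defs "HOL-Complex_Analysis.Complex_Analysis"
begin

text \<open>The helicoid is the image of some map with the prescribed fundamental forms and angle
\<open>\<phi> = - 2 am (\<surd>m u, 1/m)\<close>, where \<open>u = sinh r s + cosh r t\<close>. Any two such maps differ by a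
rotation and a translation (\<open>pseudospherical_map_unique\<close>), so it suffices to exhibit one whose
image is the negative of the image of the given parametrization.

That one is explicit. With \<open>w = cosh r s + sinh r t\<close> and \<open>\<kappa> = \<surd>(m + sinh\<^sup>2 r)\<close>, the linear
substitution \<open>2 \<pi> v = \<kappa> w\<close> turns \<open>helicoid_param\<close> into a curve depending on \<open>u\<close> that is rotated by
the angle \<open>\<Theta> = \<kappa> w + \<psi>(u)\<close> about the third axis and translated along that axis. Relative to the
orthonormal frame rotated by \<open>\<Theta>\<close>, all derivatives become polynomials in
\<open>S, C, D = sin am, cos am, dn\<close> and \<open>\<nu> = 1 / \<surd>(S\<^sup>2 + sinh\<^sup>2 r)\<close>, because the elliptic integrals
\<open>\<psi>\<close> and \<open>\<zeta>\<close> enter only through \<open>\<psi>' = - \<kappa> cosh r sinh r \<nu>\<^sup>2\<close> and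
\<open>\<zeta>' = (S\<^sup>2 + sinh\<^sup>2 r) / \<kappa>\<close>. Put \<open>n = 1 / \<nu>\<close>, \<open>R = (1, 0, 0)\<close> and
\<open>T = (0, - \<surd>m D / \<kappa>, n / \<kappa>)\<close>, two unit vectors in this frame. The partial derivatives of the
parametrization with respect to \<open>u\<close> and \<open>w\<close> are then \<open>n T\<close> and
\<open>- (C S / n) R - (cosh r sinh r / n) T\<close>. Converted back to \<open>(s, t)\<close>, the derivatives of the negative
of the map are \<open>C\<close> and \<open>- S\<close> times the unit vectors \<open>(sinh r C T + cosh r S R) / n\<close> and
\<open>(cosh r S T - sinh r C R) / n\<close>; together with their cross product these form the frame that
\<open>is_pseudospherical_map\<close> asks for, and every remaining identity follows from
\<open>S\<^sup>2 + C\<^sup>2 = 1\<close>, \<open>m D\<^sup>2 = m - S\<^sup>2\<close>, \<open>cosh\<^sup>2 r = 1 + sinh\<^sup>2 r\<close>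
and \<open>\<kappa>\<^sup>2 = m + sinh\<^sup>2 r\<close>. Since \<open>(s, t) \<mapsto> (u, v)\<close> is a bijection of the plane, the images agree
up to sign.

For uniqueness, the first fundamental form together with the symmetry of the mixed partial
derivatives and the second fundamental form determine all connection coefficients of the frame at
points where \<open>\<phi> \<notin> \<pi>\<int>\<close>; such points are dense, so the coefficients agree everywhere by continuity.
Two moving frames with equal connection coefficients differ by a constant rotation.

Real analyticity reduces to functions of one variable, since every component of the
parametrization is a sum of products of a function of \<open>u\<close> and a function of \<open>v\<close>. In one variable
it is obtained from local holomorphic extensions: the amplitude is the inverse function of an
elliptic integral of the first kind, and \<open>\<psi>\<close> and \<open>\<zeta>\<close> are antiderivatives of analytic functions.\<close>

section \<open>Real analytic functions of one and two variables\<close>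

text \<open>Analyticity at a point is encoded by a holomorphic extension rather than by a power series, so that
closure under composition, integration and inversion is inherited from complex analysis;
\<open>real_analytic_at_power_series\<close> recovers the series.\<close>

definition real_analytic_at :: "(real \<Rightarrow> real) \<Rightarrow> real \<Rightarrow> bool" where
  "real_analytic_at g a \<longleftrightarrow>
     (\<exists>G. G analytic_on {complex_of_real a} \<and>
          (\<forall>\<^sub>F x in nhds a. G (complex_of_real x) = complex_of_real (g x)))"

lemma real_analytic_atI:
  assumes "G analytic_on {complex_of_real a}"
    and "\<forall>\<^sub>F x in nhds a. G (complex_of_real x) = complex_of_real (g x)"
  shows "real_analytic_at g a"
  using assms unfolding real_analytic_at_def by blast

lemma real_analytic_atE:
  assumes "real_analytic_at g a"
  obtains G where "G analytic_on {complex_of_real a}"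
    and "\<forall>\<^sub>F x in nhds a. G (complex_of_real x) = complex_of_real (g x)"
    and "G (complex_of_real a) = complex_of_real (g a)"
  using assms unfolding real_analytic_at_def by (meson eventually_nhds_x_imp_x)

lemma real_analytic_at_const: "real_analytic_at (\<lambda>x. c) a"
  by (rule real_analytic_atI[of "\<lambda>z. complex_of_real c"]) auto

lemma real_analytic_at_ident: "real_analytic_at (\<lambda>x. x) a"
  by (rule real_analytic_atI[of "\<lambda>z. z"]) auto

lemma real_analytic_at_add:
  assumes "real_analytic_at f a" "real_analytic_at g a"
  shows "real_analytic_at (\<lambda>x. f x + g x) a"
proof -
  obtain F where F: "F analytic_on {complex_of_real a}"
    "\<forall>\<^sub>F x in nhds a. F (complex_of_real x) = complex_of_real (f x)"
    using assms(1) by (rule real_analytic_atE)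
  obtain G where G: "G analytic_on {complex_of_real a}"
    "\<forall>\<^sub>F x in nhds a. G (complex_of_real x) = complex_of_real (g x)"
    using assms(2) by (rule real_analytic_atE)
  show ?thesis
    by (rule real_analytic_atI[of "\<lambda>z. F z + G z"], intro analytic_intros F G)
      (use F(2) G(2) in eventually_elim, simp)
qed

lemma real_analytic_at_mult:
  assumes "real_analytic_at f a" "real_analytic_at g a"
  shows "real_analytic_at (\<lambda>x. f x * g x) a"
proof -
  obtain F where F: "F analytic_on {complex_of_real a}"
    "\<forall>\<^sub>F x in nhds a. F (complex_of_real x) = complex_of_real (f x)"
    using assms(1) by (rule real_analytic_atE)
  obtain G where G: "G analytic_on {complex_of_real a}"
    "\<forall>\<^sub>F x in nhds a. G (complex_of_real x) = complex_of_real (g x)"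
    using assms(2) by (rule real_analytic_atE)
  show ?thesis
    by (rule real_analytic_atI[of "\<lambda>z. F z * G z"], intro analytic_intros F G)
      (use F(2) G(2) in eventually_elim, simp)
qed

lemma isCont_tendsto_nhds:
  assumes "isCont f a" shows "(f \<longlongrightarrow> f a) (nhds a)"
  using assms by (auto simp: isCont_def tendsto_def eventually_at_filter elim!: eventually_mono
      dest: eventually_nhds_x_imp_x)

lemma real_analytic_at_uminus:
  assumes "real_analytic_at f a" shows "real_analytic_at (\<lambda>x. - f x) a"
  using real_analytic_at_mult[OF real_analytic_at_const[of "- 1"] assms] by simp

lemma real_analytic_at_compose:
  assumes "real_analytic_at f (g a)" "real_analytic_at g a"
  shows "real_analytic_at (\<lambda>x. f (g x)) a"
proof -
  obtain F where F: "F analytic_on {complex_of_real (g a)}"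
    "\<forall>\<^sub>F x in nhds (g a). F (complex_of_real x) = complex_of_real (f x)"
    using assms(1) by (rule real_analytic_atE)
  obtain G where G: "G analytic_on {complex_of_real a}"
    "\<forall>\<^sub>F x in nhds a. G (complex_of_real x) = complex_of_real (g x)"
    "G (complex_of_real a) = complex_of_real (g a)"
    using assms(2) by (rule real_analytic_atE)
  have "isCont G (complex_of_real a)"
    using G(1) analytic_at_imp_isCont by blast
  then have "isCont (\<lambda>x. Re (G (complex_of_real x))) a"
    by (intro isCont_o2[where f = complex_of_real and g = "\<lambda>z. Re (G z)"] continuous_Re) auto
  then have "((\<lambda>x. Re (G (complex_of_real x))) \<longlongrightarrow> g a) (nhds a)"
    using G(3) isCont_tendsto_nhds by fastforce
  then have "(g \<longlongrightarrow> g a) (nhds a)"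
    by (rule Lim_transform_eventually) (use G(2) in eventually_elim, simp)
  then have ev: "\<forall>\<^sub>F x in nhds a. F (complex_of_real (g x)) = complex_of_real (f (g x))"
    by (rule eventually_compose_filterlim[OF F(2)])
  show ?thesis
  proof (rule real_analytic_atI[of "F \<circ> G"])
    show "F \<circ> G analytic_on {complex_of_real a}"
      by (rule analytic_on_compose[OF G(1)]) (use F(1) G(3) in simp)
    show "\<forall>\<^sub>F x in nhds a. (F \<circ> G) (complex_of_real x) = complex_of_real (f (g x))"
      using G(2) ev by eventually_elim simp
  qed
qed

lemma real_analytic_at_sin: "real_analytic_at sin a"
  by (rule real_analytic_atI[of sin]) (auto intro!: analytic_intros simp: sin_of_real)

lemma real_analytic_at_cos: "real_analytic_at cos a"
  by (rule real_analytic_atI[of cos]) (auto intro!: analytic_intros simp: cos_of_real)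

lemma real_analytic_at_sqrt:
  assumes "0 < a" shows "real_analytic_at sqrt a"
proof (rule real_analytic_atI[of csqrt])
  show "csqrt analytic_on {complex_of_real a}"
    using assms by (auto intro!: analytic_intros simp: complex_nonpos_Reals_iff)
  have "\<forall>\<^sub>F x in nhds a. 0 < x"
    using assms by (simp add: eventually_nhds_in_open[of "{0<..}"] flip: greaterThan_iff)
  then show "\<forall>\<^sub>F x in nhds a. csqrt (complex_of_real x) = complex_of_real (sqrt x)"
    by eventually_elim simp
qed

lemma real_analytic_at_inverse:
  assumes "a \<noteq> 0" shows "real_analytic_at inverse a"
  by (rule real_analytic_atI[of inverse]) (use assms in \<open>auto intro!: analytic_intros\<close>)

text \<open>The extension of the derivative has a holomorphic primitive on a disc, and on the real diameter this
primitive differs from \<open>g\<close> by a constant.\<close>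

lemma real_analytic_at_primitive:
  assumes "real_analytic_at h a" and der: "\<And>x. (g has_real_derivative h x) (at x)"
  shows "real_analytic_at g a"
proof -
  obtain H where H: "H analytic_on {complex_of_real a}"
    "\<forall>\<^sub>F x in nhds a. H (complex_of_real x) = complex_of_real (h x)"
    using assms(1) by (rule real_analytic_atE)
  obtain e1 where e1: "e1 > 0" "H holomorphic_on ball (complex_of_real a) e1"
    using H(1) by (auto simp: analytic_on_def)
  obtain e2 where e2: "e2 > 0" "\<And>x. dist x a < e2 \<Longrightarrow> H (complex_of_real x) = complex_of_real (h x)"
    using H(2) by (auto simp: eventually_nhds_metric)
  define e where "e = min e1 e2"
  have e: "e > 0" using e1 e2 by (simp add: e_def)
  let ?B = "ball (complex_of_real a) e"
  have "H holomorphic_on ?B"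
    using e1(2) by (rule holomorphic_on_subset) (auto simp: e_def)
  then obtain P where P0: "\<And>z. z \<in> ?B \<Longrightarrow> (P has_field_derivative H z) (at z within ?B)"
    using holomorphic_convex_primitive'[of ?B H] by auto
  then have P: "(P has_field_derivative H z) (at z)" if "z \<in> ?B" for z
    using that at_within_open[of z ?B] by force
  have reals: "(complex_of_real x \<in> ?B) = (dist x a < e)" for x
    by (metis dist_commute dist_of_real mem_ball)
  have d0: "((\<lambda>x. P (complex_of_real x) - complex_of_real (g x)) has_vector_derivative 0) (at x within ball a e)"
    if "x \<in> ball a e" for x
  proof -
    have x: "dist x a < e" using that by (simp add: dist_commute)
    have "((\<lambda>x. P (complex_of_real x)) has_vector_derivative H (complex_of_real x)) (at x within ball a e)"
      using P[of "complex_of_real x"] x reals by (intro has_vector_derivative_real_field) auto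
    moreover have "((\<lambda>x. complex_of_real (g x)) has_vector_derivative complex_of_real (h x)) (at x within ball a e)"
      using der[of x] by (intro has_vector_derivative_of_real)
        (auto simp: has_real_derivative_iff_has_vector_derivative intro: has_vector_derivative_at_within)
    ultimately show ?thesis
      using has_vector_derivative_diff e2(2)[of x] x by (fastforce simp: e_def)
  qed
  obtain c where c: "\<And>x. x \<in> ball a e \<Longrightarrow> P (complex_of_real x) - complex_of_real (g x) = c"
    using has_vector_derivative_zero_constant[OF convex_ball d0] by metis
  show ?thesis
  proof (rule real_analytic_atI[of "\<lambda>z. P z - c"])
    have "(\<lambda>z. P z - c) holomorphic_on ?B"
      by (intro holomorphic_intros) (use P in \<open>metis holomorphic_on_open open_ball\<close>)
    then show "(\<lambda>z. P z - c) analytic_on {complex_of_real a}"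
      using e by (auto simp: analytic_on_def)
    show "\<forall>\<^sub>F x in nhds a. P (complex_of_real x) - c = complex_of_real (g x)"
      unfolding eventually_nhds_metric
      using e c by (intro exI[of _ e]) (auto simp: dist_commute algebra_simps)
  qed
qed

text \<open>The extension \<open>H\<close> of \<open>F\<close> has the nonzero complex derivative \<open>D\<close> at \<open>g a\<close>, so it is injective near
that point with a holomorphic inverse. Continuity of \<open>g\<close> keeps its values in the region where the
inverse agrees with \<open>g\<close>.\<close>

lemma real_analytic_at_inverse_function:
  assumes F: "real_analytic_at F (g a)"
    and der: "(F has_real_derivative D) (at (g a))" and "D \<noteq> 0"
    and inv: "\<And>x. F (g x) = x" and cont: "isCont g a"
  shows "real_analytic_at g a"
proof -
  define b where "b = g a"
  obtain H where H: "H analytic_on {complex_of_real b}"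
    "\<forall>\<^sub>F x in nhds b. H (complex_of_real x) = complex_of_real (F x)"
    using F unfolding b_def by (rule real_analytic_atE)
  obtain e1 where e1: "e1 > 0" "H holomorphic_on ball (complex_of_real b) e1"
    using H(1) by (auto simp: analytic_on_def)
  obtain e2 where e2: "e2 > 0" "\<And>x. dist x b < e2 \<Longrightarrow> H (complex_of_real x) = complex_of_real (F x)"
    using H(2) by (auto simp: eventually_nhds_metric)
  define e where "e = min e1 e2"
  have e: "e > 0" using e1 e2 by (simp add: e_def)
  let ?B = "ball (complex_of_real b) e"
  have hol: "H holomorphic_on ?B"
    using e1(2) by (rule holomorphic_on_subset) (auto simp: e_def)
  have "(H has_field_derivative deriv H (complex_of_real b)) (at (complex_of_real b))"
    using H(1) analytic_on_imp_differentiable_at field_differentiable_derivI by blast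
  then have "((\<lambda>x. H (complex_of_real x)) has_vector_derivative deriv H (complex_of_real b)) (at b)"
    by (rule has_vector_derivative_real_field)
  then have "((\<lambda>x. complex_of_real (F x)) has_vector_derivative deriv H (complex_of_real b)) (at b)"
    by (rule has_vector_derivative_transform_within[OF _ e2(1)]) (use e2(2) in \<open>auto simp: dist_commute\<close>)
  moreover have "((\<lambda>x. complex_of_real (F x)) has_vector_derivative complex_of_real D) (at b)"
    using der unfolding b_def
    by (intro has_vector_derivative_of_real) (simp add: has_real_derivative_iff_has_vector_derivative)
  ultimately have "deriv H (complex_of_real b) = complex_of_real D"
    by (rule vector_derivative_unique_at)
  with \<open>D \<noteq> 0\<close> have nz: "deriv H (complex_of_real b) \<noteq> 0" by simp
  obtain r where r: "r > 0" "ball (complex_of_real b) r \<subseteq> ?B" "inj_on H (ball (complex_of_real b) r)"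
    using has_complex_derivative_locally_injective[OF hol _ _ nz] e by auto
  let ?C = "ball (complex_of_real b) r"
  have holC: "H holomorphic_on ?C" using hol r(2) by (rule holomorphic_on_subset)
  obtain K where K: "K holomorphic_on (H ` ?C)" "\<And>z. z \<in> ?C \<Longrightarrow> K (H z) = z"
    using holomorphic_has_inverse[OF holC open_ball r(3)] by metis
  have opn: "open (H ` ?C)" by (rule open_mapping_thm3[OF holC open_ball r(3)])
  have Fb: "H (complex_of_real b) = complex_of_real a"
    using e2(2)[of b] e2(1) inv[of a] by (simp add: b_def)
  show ?thesis
  proof (rule real_analytic_atI[of K])
    have "complex_of_real a \<in> H ` ?C"
      using r(1) by (metis Fb centre_in_ball imageI)
    then show "K analytic_on {complex_of_real a}"
      using K(1) opn analytic_on_subset[of K "H ` ?C"] by (auto simp: analytic_on_open)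
    have "\<forall>\<^sub>F x in nhds a. dist (g x) b < min r e2"
      using cont r(1) e2(1) unfolding b_def
      by (intro tendstoD isCont_tendsto_nhds) auto
    then show "\<forall>\<^sub>F x in nhds a. K (complex_of_real x) = complex_of_real (g x)"
    proof eventually_elim
      case (elim x)
      then have "complex_of_real (g x) \<in> ?C"
        by (simp add: dist_of_real dist_commute[of b])
      then have "K (H (complex_of_real (g x))) = complex_of_real (g x)" by (rule K(2))
      with elim e2(2)[of "g x"] inv show ?case by simp
    qed
  qed
qed

lemma real_analytic_at_power_series:
  assumes "real_analytic_at g a"
  obtains c :: "nat \<Rightarrow> real" and e :: real where "e > 0"
    and "\<And>x. \<bar>x - a\<bar> < e \<Longrightarrow> summable (\<lambda>i. norm (c i * (x - a) ^ i))"
    and "\<And>x. \<bar>x - a\<bar> < e \<Longrightarrow> ((\<lambda>i. c i * (x - a) ^ i) has_sum g x) UNIV"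
proof -
  obtain G where G: "G analytic_on {complex_of_real a}"
    "\<forall>\<^sub>F x in nhds a. G (complex_of_real x) = complex_of_real (g x)"
    using assms by (rule real_analytic_atE)
  obtain e1 where e1: "e1 > 0" "G holomorphic_on ball (complex_of_real a) e1"
    using G(1) by (auto simp: analytic_on_def)
  obtain e2 where e2: "e2 > 0" "\<And>x. dist x a < e2 \<Longrightarrow> G (complex_of_real x) = complex_of_real (g x)"
    using G(2) by (auto simp: eventually_nhds_metric)
  define e where "e = min e1 e2"
  define c where "c = (\<lambda>n. Re ((deriv ^^ n) G (complex_of_real a) / fact n))"
  have e: "e > 0" using e1 e2 by (simp add: e_def)
  have sums: "(\<lambda>n. c n * (x - a) ^ n) sums g x" if "\<bar>x - a\<bar> < e" for x
  proof -
    have "complex_of_real x \<in> ball (complex_of_real a) e1"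
      using that by (simp add: e_def dist_real_def abs_minus_commute dist_of_real)
    from holomorphic_power_series[OF e1(2) this]
    have "(\<lambda>n. (deriv ^^ n) G (complex_of_real a) / fact n * complex_of_real ((x - a) ^ n)) sums complex_of_real (g x)"
      using e2(2)[of x] that by (simp add: e_def dist_real_def)
    moreover have "Re (w * complex_of_real y) = Re w * y" for w y by simp
    ultimately show ?thesis using sums_Re by (fastforce simp only: c_def Re_complex_of_real)
  qed
  have abs: "summable (\<lambda>n. norm (c n * (x - a) ^ n))" if x: "\<bar>x - a\<bar> < e" for x
  proof -
    \<comment> \<open>A power series converges absolutely at points closer to the centre than a point of convergence.\<close>
    define y where "y = (\<bar>x - a\<bar> + e) / 2"
    have "\<bar>(a + y) - a\<bar> < e" "norm (x - a) < norm y" using x by (auto simp: y_def)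
    then show ?thesis
      using powser_insidea[of c y "x - a"] sums[of "a + y"] by (simp add: sums_iff)
  qed
  show ?thesis
  proof (rule that[of e c])
    show "((\<lambda>i. c i * (x - a) ^ i) has_sum g x) UNIV" if "\<bar>x - a\<bar> < e" for x
      by (rule norm_summable_imp_has_sum[OF abs[OF that] sums[OF that]])
  qed (fact e, fact abs)
qed

text \<open>The product of two absolutely convergent one-variable series is summable over pairs of exponents.\<close>

lemma real_analytic_product:
  assumes "\<And>a. real_analytic_at g a" "\<And>b. real_analytic_at h b"
  shows "real_analytic (\<lambda>(u, v). g u * h v)"
  unfolding real_analytic_def
proof (intro allI)
  fix a b :: real
  obtain c e where c: "e > 0"
    "\<And>x. \<bar>x - a\<bar> < e \<Longrightarrow> summable (\<lambda>i. norm (c i * (x - a) ^ i))"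
    "\<And>x. \<bar>x - a\<bar> < e \<Longrightarrow> ((\<lambda>i. c i * (x - a) ^ i) has_sum g x) UNIV"
    using real_analytic_at_power_series[OF assms(1)[of a]] by metis
  obtain c' e' where c': "e' > 0"
    "\<And>x. \<bar>x - b\<bar> < e' \<Longrightarrow> summable (\<lambda>i. norm (c' i * (x - b) ^ i))"
    "\<And>x. \<bar>x - b\<bar> < e' \<Longrightarrow> ((\<lambda>i. c' i * (x - b) ^ i) has_sum h x) UNIV"
    using real_analytic_at_power_series[OF assms(2)[of b]] by metis
  show "\<exists>c :: nat \<times> nat \<Rightarrow> real. \<exists>\<epsilon>>0. \<forall>x y. \<bar>x - a\<bar> < \<epsilon> \<longrightarrow> \<bar>y - b\<bar> < \<epsilon> \<longrightarrow>
        ((\<lambda>(i, j). ((x - a) ^ i * (y - b) ^ j) *\<^sub>R c (i, j)) has_sum (case (x, y) of (u, v) \<Rightarrow> g u * h v)) UNIV"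
  proof (intro exI[of _ "\<lambda>(i, j). c i * c' j"] exI[of _ "min e e'"] conjI allI impI)
    show "min e e' > 0" using c(1) c'(1) by simp
    fix x y assume xy: "\<bar>x - a\<bar> < min e e'" "\<bar>y - b\<bar> < min e e'"
    let ?p = "\<lambda>i. c i * (x - a) ^ i" and ?q = "\<lambda>j. c' j * (y - b) ^ j"
    have p: "summable (\<lambda>i. norm (?p i))" "(?p has_sum g x) UNIV" using c xy by auto
    have q: "summable (\<lambda>i. norm (?q i))" "(?q has_sum h y) UNIV" using c' xy by auto
    have absq: "(\<lambda>j. norm (?q j)) summable_on UNIV" and absp: "(\<lambda>i. norm (?p i)) summable_on UNIV"
      using p(1) q(1) by (auto intro!: norm_summable_imp_summable_on)
    have "(\<lambda>ij. norm ((\<lambda>(i, j). ?p i * ?q j) ij)) summable_on (SIGMA i:UNIV. UNIV)"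
    proof (subst Infinite_Sum.abs_summable_on_Sigma_iff, intro conjI ballI)
      fix i show "(\<lambda>j. norm (case (i, j) of (i, j) \<Rightarrow> ?p i * ?q j)) summable_on UNIV"
        using summable_on_cmult_right[OF absq, of "norm (?p i)"] by (simp add: abs_mult)
    next
      have "(\<lambda>i. norm (?p i) * (\<Sum>\<^sub>\<infinity>j. norm (?q j))) summable_on UNIV"
        by (rule summable_on_cmult_left[OF absp])
      then show "(\<lambda>i. norm (\<Sum>\<^sub>\<infinity>j\<in>UNIV. norm (case (i, j) of (i, j) \<Rightarrow> ?p i * ?q j))) summable_on UNIV"
        by (simp add: abs_mult infsum_cmult_right' infsum_nonneg mult.assoc)
    qed
    then have "(\<lambda>(i, j). ?p i * ?q j) summable_on (SIGMA i:UNIV. UNIV)"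
      by (rule abs_summable_summable)
    then have "((\<lambda>(i, j). ?p i * ?q j) has_sum g x * h y) (SIGMA i:UNIV. UNIV)"
      by (intro has_sum_SigmaI[where g = "\<lambda>i. ?p i * h y"])
        (auto intro!: has_sum_cmult_right has_sum_cmult_left p q)
    then show "((\<lambda>(i, j). ((x - a) ^ i * (y - b) ^ j) *\<^sub>R (case (i, j) of (i, j) \<Rightarrow> c i * c' j)) has_sum (case (x, y) of (u, v) \<Rightarrow> g u * h v)) UNIV"
      by (simp add: ac_simps case_prod_unfold)
  qed
qed

lemma real_analytic_add:
  fixes f g :: "real \<times> real \<Rightarrow> 'b::euclidean_space"
  assumes "real_analytic f" "real_analytic g"
  shows "real_analytic (\<lambda>p. f p + g p)"
  unfolding real_analytic_def
proof (intro allI)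
  fix a b :: real
  obtain c :: "nat \<times> nat \<Rightarrow> 'b" and e where c: "e > 0" "\<forall>x y. \<bar>x - a\<bar> < e \<longrightarrow> \<bar>y - b\<bar> < e \<longrightarrow>
        ((\<lambda>(i, j). ((x - a) ^ i * (y - b) ^ j) *\<^sub>R c (i, j)) has_sum f (x, y)) UNIV"
    using assms(1)[unfolded real_analytic_def, THEN spec, THEN spec, of a b] by (elim exE conjE) (rule that)
  obtain c' :: "nat \<times> nat \<Rightarrow> 'b" and e' where c': "e' > 0" "\<forall>x y. \<bar>x - a\<bar> < e' \<longrightarrow> \<bar>y - b\<bar> < e' \<longrightarrow>
        ((\<lambda>(i, j). ((x - a) ^ i * (y - b) ^ j) *\<^sub>R c' (i, j)) has_sum g (x, y)) UNIV"
    using assms(2)[unfolded real_analytic_def, THEN spec, THEN spec, of a b] by (elim exE conjE) (rule that)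
  show "\<exists>c. \<exists>\<epsilon>>0. \<forall>x y. \<bar>x - a\<bar> < \<epsilon> \<longrightarrow> \<bar>y - b\<bar> < \<epsilon> \<longrightarrow>
        ((\<lambda>(i, j). ((x - a) ^ i * (y - b) ^ j) *\<^sub>R c (i, j)) has_sum f (x, y) + g (x, y)) UNIV"
  proof (intro exI[of _ "\<lambda>p. c p + c' p"] exI[of _ "min e e'"] conjI allI impI)
    show "min e e' > 0" using c(1) c'(1) by simp
    fix x y assume xy: "\<bar>x - a\<bar> < min e e'" "\<bar>y - b\<bar> < min e e'"
    show "((\<lambda>(i, j). ((x - a) ^ i * (y - b) ^ j) *\<^sub>R (c (i, j) + c' (i, j))) has_sum f (x, y) + g (x, y)) UNIV"
      using has_sum_add[OF c(2)[rule_format, of x y] c'(2)[rule_format, of x y]] xy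
      by (simp add: case_prod_unfold scaleR_add_right)
  qed
qed

lemma real_analytic_linear_image:
  fixes f :: "real \<times> real \<Rightarrow> 'b::euclidean_space" and L :: "'b \<Rightarrow> 'c::euclidean_space"
  assumes "bounded_linear L" "real_analytic f"
  shows "real_analytic (\<lambda>p. L (f p))"
  unfolding real_analytic_def
proof (intro allI)
  fix a b :: real
  interpret bounded_linear L by fact
  obtain c :: "nat \<times> nat \<Rightarrow> 'b" and e where c: "e > 0" "\<forall>x y. \<bar>x - a\<bar> < e \<longrightarrow> \<bar>y - b\<bar> < e \<longrightarrow>
        ((\<lambda>(i, j). ((x - a) ^ i * (y - b) ^ j) *\<^sub>R c (i, j)) has_sum f (x, y)) UNIV"
    using assms(2)[unfolded real_analytic_def, THEN spec, THEN spec, of a b] by (elim exE conjE) (rule that)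
  show "\<exists>c. \<exists>\<epsilon>>0. \<forall>x y. \<bar>x - a\<bar> < \<epsilon> \<longrightarrow> \<bar>y - b\<bar> < \<epsilon> \<longrightarrow>
        ((\<lambda>(i, j). ((x - a) ^ i * (y - b) ^ j) *\<^sub>R c (i, j)) has_sum L (f (x, y))) UNIV"
  proof (intro exI[of _ "\<lambda>p. L (c p)"] exI[of _ e] conjI allI impI)
    show "e > 0" by (rule c(1))
    fix x y assume "\<bar>x - a\<bar> < e" "\<bar>y - b\<bar> < e"
    from has_sum_bounded_linear[OF assms(1) c(2)[rule_format, OF this]]
    show "((\<lambda>(i, j). ((x - a) ^ i * (y - b) ^ j) *\<^sub>R L (c (i, j))) has_sum L (f (x, y))) UNIV"
      by (simp add: case_prod_unfold scaleR)
  qed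
qed

lemma real_analytic_vector3:
  assumes "real_analytic f1" "real_analytic f2" "real_analytic f3"
  shows "real_analytic (\<lambda>p. vector [f1 p, f2 p, f3 p] :: real ^ 3)"
proof -
  have "(\<lambda>p. vector [f1 p, f2 p, f3 p] :: real ^ 3)
      = (\<lambda>p. f1 p *\<^sub>R axis 1 1 + f2 p *\<^sub>R axis 2 1 + f3 p *\<^sub>R axis 3 1)"
    by (simp add: fun_eq_iff vec_eq_iff forall_3 axis_def)
  then show ?thesis
    by (simp only:) (intro real_analytic_add real_analytic_linear_image[of "\<lambda>t. t *\<^sub>R _"]
        bounded_linear_scaleR_left assms)
qed

section \<open>The Jacobi amplitude\<close>

lemma interval_integral_has_real_derivative:
  fixes f :: "real \<Rightarrow> real"
  assumes "continuous_on UNIV f"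
  shows "((\<lambda>u. LBINT y=0..ereal u. f y) has_real_derivative f x) (at x)"
proof -
  define a where "a = min 0 x - 1"
  define b where "b = max 0 x + 1"
  have "((\<lambda>u. LBINT y=ereal 0..ereal u. f y) has_vector_derivative f x) (at x within {a..b})"
    by (rule interval_integral_FTC2)
      (use assms in \<open>auto simp: a_def b_def intro: continuous_on_subset\<close>)
  then have "((\<lambda>u. LBINT y=ereal 0..ereal u. f y) has_vector_derivative f x) (at x within {a<..<b})"
    by (rule has_vector_derivative_within_subset) auto
  moreover have "x \<in> {a<..<b}" by (simp add: a_def b_def min_def max_def)
  ultimately show ?thesis
    using at_within_open[of x "{a<..<b}"]
    by (simp add: zero_ereal_def has_real_derivative_iff_has_vector_derivative)
qed

text \<open>The bound makes \<open>h exp (- K u)\<close> nonincreasing and \<open>h exp (K u)\<close> nondecreasing; the first forces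
\<open>h\<close> to vanish for \<open>u \<ge> 0\<close>, the second for \<open>u \<le> 0\<close>.\<close>

lemma gronwall_zero:
  fixes h :: "real \<Rightarrow> real"
  assumes der: "\<And>u. (h has_real_derivative h' u) (at u)"
    and bound: "\<And>u. \<bar>h' u\<bar> \<le> K * h u" and "\<And>u. h u \<ge> 0" and "h 0 = 0"
  shows "h u = 0"
proof -
  have K: "- K * h u \<le> h' u" "h' u \<le> K * h u" for u using bound[of u] by auto
  have 1: "((\<lambda>u. h u * exp (- K * u)) has_real_derivative (h' u - K * h u) * exp (- K * u)) (at u)" for u
    by (auto intro!: derivative_eq_intros der simp: algebra_simps)
  have 2: "((\<lambda>u. h u * exp (K * u)) has_real_derivative (h' u + K * h u) * exp (K * u)) (at u)" for u
    by (auto intro!: derivative_eq_intros der simp: algebra_simps)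
  have "h u \<le> 0"
  proof (cases "u \<ge> 0")
    case True
    have "h u * exp (- K * u) \<le> h 0 * exp (- K * 0)"
      by (rule DERIV_nonpos_imp_nonincreasing[OF True])
        (use 1 K(2) in \<open>force intro!: mult_nonpos_nonneg\<close>)
    then show ?thesis using \<open>h 0 = 0\<close> by (simp add: mult_le_0_iff)
  next
    case False
    then have "u \<le> 0" by simp
    then have "h u * exp (K * u) \<le> h 0 * exp (K * 0)"
    proof (rule DERIV_nonneg_imp_nondecreasing)
      fix x show "\<exists>y. ((\<lambda>u. h u * exp (K * u)) has_real_derivative y) (at x) \<and> 0 \<le> y"
        using 2[of x] K(1)[of x] by (intro exI conjI) (assumption, simp)
    qed
    then show ?thesis using \<open>h 0 = 0\<close> by (simp add: mult_le_0_iff)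
  qed
  with assms(3)[of u] show ?thesis by simp
qed

lemma abs_sin_cos_diff_le: "\<bar>sin x * cos x - sin y * cos y\<bar> \<le> \<bar>x - y\<bar>" for x y :: real
proof -
  have "sin (x - y) * cos (x + y) = (sin (2 * x) + sin (- (2 * y))) / 2"
    by (simp add: sin_times_cos)
  then have "sin x * cos x - sin y * cos y = sin (x - y) * cos (x + y)"
    by (simp only: sin_minus sin_double) simp
  moreover have "\<bar>sin (x - y) * cos (x + y)\<bar> \<le> \<bar>x - y\<bar> * 1"
    unfolding abs_mult by (intro mult_mono abs_sin_x_le_abs_x) auto
  ultimately show ?thesis by simp
qed

text \<open>The right-hand side \<open>- \<mu> sin \<theta> cos \<theta>\<close> is Lipschitz in \<open>\<theta>\<close> with constant \<open>\<bar>\<mu>\<bar>\<close>, so the squared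
distance of two solutions in the phase plane satisfies the hypothesis of \<open>gronwall_zero\<close>.\<close>

lemma is_jacobi_am_unique:
  assumes "is_jacobi_am \<mu> \<theta>" "is_jacobi_am \<mu> \<eta>"
  shows "\<theta> = \<eta>"
proof
  fix u
  obtain \<theta>' where t: "\<And>u. (\<theta> has_real_derivative \<theta>' u) (at u)"
    "\<And>u. (\<theta>' has_real_derivative - \<mu> * sin (\<theta> u) * cos (\<theta> u)) (at u)" "\<theta> 0 = 0" "\<theta>' 0 = 1"
    using assms(1) unfolding is_jacobi_am_def by blast
  obtain \<eta>' where e: "\<And>u. (\<eta> has_real_derivative \<eta>' u) (at u)"
    "\<And>u. (\<eta>' has_real_derivative - \<mu> * sin (\<eta> u) * cos (\<eta> u)) (at u)" "\<eta> 0 = 0" "\<eta>' 0 = 1"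
    using assms(2) unfolding is_jacobi_am_def by blast
  define p where "p u = \<theta> u - \<eta> u" for u
  define q where "q u = \<theta>' u - \<eta>' u" for u
  define d where "d u = sin (\<theta> u) * cos (\<theta> u) - sin (\<eta> u) * cos (\<eta> u)" for u
  define E where "E u = (p u)\<^sup>2 + (q u)\<^sup>2" for u
  have E': "(E has_real_derivative 2 * p u * q u - 2 * \<mu> * q u * d u) (at u)" for u
    unfolding E_def p_def q_def d_def
    by (auto intro!: derivative_eq_intros t e simp: algebra_simps)
  have bound: "\<bar>2 * p u * q u - 2 * \<mu> * q u * d u\<bar> \<le> (1 + \<bar>\<mu>\<bar>) * E u" for u
  proof -
    have d: "\<bar>d u\<bar> \<le> \<bar>p u\<bar>" unfolding d_def p_def by (rule abs_sin_cos_diff_le)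
    have pq: "2 * (\<bar>p u\<bar> * \<bar>q u\<bar>) \<le> E u"
      using sum_squares_bound[of "\<bar>p u\<bar>" "\<bar>q u\<bar>"] by (simp add: E_def)
    have "\<bar>2 * p u * q u - 2 * \<mu> * q u * d u\<bar> \<le> 2 * (\<bar>p u\<bar> * \<bar>q u\<bar>) + \<bar>\<mu>\<bar> * (2 * (\<bar>d u\<bar> * \<bar>q u\<bar>))"
      by (rule order_trans[OF abs_triangle_ineq4]) (simp add: abs_mult)
    also have "\<dots> \<le> 2 * (\<bar>p u\<bar> * \<bar>q u\<bar>) + \<bar>\<mu>\<bar> * (2 * (\<bar>p u\<bar> * \<bar>q u\<bar>))"
      using d by (intro add_left_mono mult_left_mono mult_right_mono) auto
    also have "\<dots> = (1 + \<bar>\<mu>\<bar>) * (2 * (\<bar>p u\<bar> * \<bar>q u\<bar>))" by (simp add: algebra_simps)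
    also have "\<dots> \<le> (1 + \<bar>\<mu>\<bar>) * E u" using pq by (intro mult_left_mono) auto
    finally show ?thesis .
  qed
  have "E u = 0"
    by (rule gronwall_zero[OF E' bound]) (auto simp: E_def p_def q_def t e)
  then show "\<theta> u = \<eta> u" by (simp add: E_def p_def sum_power2_eq_zero_iff)
qed

lemma jacobi_am_eqI:
  assumes "is_jacobi_am \<mu> \<theta>" shows "jacobi_am u \<mu> = \<theta> u"
proof -
  have "(THE \<theta>. is_jacobi_am \<mu> \<theta>) = \<theta>"
    using assms by (intro the_equality) (auto intro: is_jacobi_am_unique)
  then show ?thesis by (simp add: jacobi_am_def)
qed

lemma one_minus_mult_sin_sq_pos:
  fixes \<mu> :: real assumes "\<mu> < 1" shows "0 < 1 - \<mu> * (sin x)\<^sup>2"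
proof (cases "\<mu> \<le> 0")
  case True then show ?thesis by (smt (verit) mult_nonpos_nonneg zero_le_power2)
next
  case False
  then have "\<mu> * (sin x)\<^sup>2 \<le> \<mu> * 1"
    using abs_sin_le_one[of x] by (intro mult_left_mono) (auto simp: abs_square_le_1)
  with assms show ?thesis by simp
qed

text \<open>For parameters in \<open>[0, 1)\<close> the integrand of the elliptic integral \<open>F\<close> of the first kind is at least
\<open>1\<close>, so \<open>F\<close> is a bijection of the line whose inverse \<open>\<theta>\<close> is nonexpansive. Differentiating
\<open>F (\<theta> u) = u\<close> twice gives the defining equation of the amplitude, and analyticity of \<open>F\<close> passes to
its inverse.\<close>

lemma jacobi_am_elliptic:
  fixes \<mu> :: real
  assumes "0 \<le> \<mu>" "\<mu> < 1"
  shows is_jacobi_am_elliptic: "is_jacobi_am \<mu> (\<lambda>u. jacobi_am u \<mu>)"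
    and DERIV_jacobi_am: "((\<lambda>u. jacobi_am u \<mu>) has_real_derivative sqrt (1 - \<mu> * (sin (jacobi_am u \<mu>))\<^sup>2)) (at u)"
    and real_analytic_at_jacobi_am: "real_analytic_at (\<lambda>u. jacobi_am u \<mu>) u"
proof -
  define f where "f x = inverse (sqrt (1 - \<mu> * (sin x)\<^sup>2))" for x :: real
  define F where "F \<phi> = (LBINT x=0..ereal \<phi>. f x)" for \<phi> :: real
  have pos: "0 < 1 - \<mu> * (sin x)\<^sup>2" for x :: real
    by (rule one_minus_mult_sin_sq_pos) (rule assms)
  have cont: "continuous_on UNIV f"
    unfolding f_def using pos by (intro continuous_intros) (metis less_irrefl real_sqrt_eq_zero_cancel_iff UNIV_I)
  have F': "(F has_real_derivative f x) (at x)" for x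
    unfolding F_def by (rule interval_integral_has_real_derivative[OF cont])
  have f1: "1 \<le> f x" for x
    unfolding f_def using pos[of x] assms(1) by (intro one_le_inverse) auto
  have grow: "y - x \<le> F y - F x" if "x \<le> y" for x y
  proof -
    have "(\<lambda>x. F x - x) x \<le> (\<lambda>x. F x - x) y"
    proof (rule DERIV_nonneg_imp_nondecreasing[OF that])
      fix x show "\<exists>d. ((\<lambda>x. F x - x) has_real_derivative d) (at x) \<and> 0 \<le> d"
        using f1[of x] by (intro exI[of _ "f x - 1"]) (auto intro!: derivative_eq_intros F')
    qed
    then show ?thesis by simp
  qed
  have F0: "F 0 = 0" by (simp add: F_def zero_ereal_def)
  have contF: "continuous_on A F" for A
    using F' by (meson DERIV_isCont continuous_at_imp_continuous_on)
  have "\<exists>x. F x = y" for y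
  proof -
    have "\<exists>x\<ge>- \<bar>y\<bar>. x \<le> \<bar>y\<bar> \<and> F x = y"
      by (rule IVT') (use grow[of 0 "\<bar>y\<bar>"] grow[of "- \<bar>y\<bar>" 0] F0 contF in auto)
    then show ?thesis by blast
  qed
  then obtain \<theta> where \<theta>: "F (\<theta> y) = y" for y by metis
  have inj: "x = y" if "F x = F y" for x y
  proof (cases "x \<le> y")
    case True with grow[OF True] that show ?thesis by simp
  next
    case False with grow[of y x] that show ?thesis by simp
  qed
  have lip: "dist (\<theta> x) (\<theta> y) \<le> dist x y" for x y
    using grow[of "\<theta> x" "\<theta> y"] grow[of "\<theta> y" "\<theta> x"] \<theta>[of x] \<theta>[of y]
    by (cases "\<theta> x \<le> \<theta> y") (simp_all add: dist_real_def)
  have cont\<theta>: "isCont \<theta> u" for u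
    unfolding continuous_at_eps_delta using lip by (metis le_less_trans)
  have \<theta>': "(\<theta> has_real_derivative sqrt (1 - \<mu> * (sin (\<theta> u))\<^sup>2)) (at u)" for u
    using DERIV_inverse_function[where f = F and g = \<theta> and x = u and D = "f (\<theta> u)" and a = "u - 1" and b = "u + 1"] F' f1[of "\<theta> u"] \<theta> cont\<theta> pos[of "\<theta> u"]
    by (simp add: f_def)
  have \<theta>0: "\<theta> 0 = 0" using inj \<theta> F0 by metis
  have "((\<lambda>u. sqrt (1 - \<mu> * (sin (\<theta> u))\<^sup>2)) has_real_derivative - \<mu> * sin (\<theta> u) * cos (\<theta> u)) (at u)" for u
    using pos[of "\<theta> u"] by (auto intro!: derivative_eq_intros \<theta>' simp: divide_simps)
  then have jac: "is_jacobi_am \<mu> \<theta>"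
    unfolding is_jacobi_am_def using \<theta>' \<theta>0
    by (intro exI[of _ "\<lambda>u. sqrt (1 - \<mu> * (sin (\<theta> u))\<^sup>2)"]) auto
  have "real_analytic_at f x" for x
  proof -
    have "real_analytic_at (\<lambda>x. inverse (sqrt (1 + (- \<mu>) * (sin x * sin x)))) x"
      using pos[of x]
      by (intro real_analytic_at_compose[of inverse "\<lambda>x. sqrt (1 + (- \<mu>) * (sin x * sin x))"]
          real_analytic_at_compose[of sqrt "\<lambda>x. 1 + (- \<mu>) * (sin x * sin x)"]
          real_analytic_at_inverse real_analytic_at_sqrt
          real_analytic_at_add real_analytic_at_mult real_analytic_at_const real_analytic_at_sin)
        (auto simp: power2_eq_square)
    then show ?thesis by (simp add: f_def[abs_def] power2_eq_square)
  qed
  then have "real_analytic_at F x" for x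
    using F' by (rule real_analytic_at_primitive)
  then have ana: "real_analytic_at \<theta> u" for u
    by (rule real_analytic_at_inverse_function[OF _ F'[of "\<theta> u"] _ \<theta> cont\<theta>])
      (use f1[of "\<theta> u"] in simp)
  have eq: "(\<lambda>u. jacobi_am u \<mu>) = \<theta>" using jacobi_am_eqI[OF jac] by auto
  show "is_jacobi_am \<mu> (\<lambda>u. jacobi_am u \<mu>)" unfolding eq by (rule jac)
  show "((\<lambda>u. jacobi_am u \<mu>) has_real_derivative sqrt (1 - \<mu> * (sin (jacobi_am u \<mu>))\<^sup>2)) (at u)"
    unfolding jacobi_am_eqI[OF jac] by (rule \<theta>')
  show "real_analytic_at (\<lambda>u. jacobi_am u \<mu>) u" unfolding eq by (rule ana)
qed

lemma jacobi_am_zero: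
  assumes "0 \<le> \<mu>" "\<mu> < 1" shows "jacobi_am 0 \<mu> = 0"
  using is_jacobi_am_elliptic[OF assms] by (auto simp: is_jacobi_am_def)

text \<open>For parameters above \<open>1\<close> the amplitude oscillates and is expressed through the one with the
reciprocal parameter: \<open>arcsin (sin (\<alpha> u) / \<surd>m)\<close> has derivative \<open>cos (\<alpha> u)\<close>, and this pair solves
the defining initial value problem.\<close>

lemma jacobi_reciprocal:
  fixes m :: real
  assumes "1 < m"
  defines "\<alpha> \<equiv> \<lambda>u. jacobi_am (sqrt m * u) (1 / m)"
  shows jacobi_sn_reciprocal: "jacobi_sn u m = sin (\<alpha> u) / sqrt m"
    and jacobi_cn_reciprocal: "jacobi_cn u m = sqrt (1 - 1 / m * (sin (\<alpha> u))\<^sup>2)"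
    and jacobi_dn_reciprocal: "jacobi_dn u m = cos (\<alpha> u)"
proof -
  have \<mu>: "0 \<le> 1 / m" "1 / m < 1" using assms(1) by auto
  define D where "D u = sqrt (1 - 1 / m * (sin (\<alpha> u))\<^sup>2)" for u
  have pos: "0 < 1 - 1 / m * (sin (\<alpha> u))\<^sup>2" for u
    by (rule one_minus_mult_sin_sq_pos[OF \<mu>(2)])
  have \<alpha>': "(\<alpha> has_real_derivative D u * sqrt m) (at u)" for u
    unfolding \<alpha>_def D_def
    by (rule DERIV_chain2[OF DERIV_jacobi_am[OF \<mu>]]) (auto intro!: derivative_eq_intros)
  define \<theta> where "\<theta> u = arcsin (sin (\<alpha> u) / sqrt m)" for u
  have sq: "(sin (\<alpha> u) / sqrt m)\<^sup>2 < 1" for u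
    using pos[of u] assms(1) by (simp add: power_divide)
  have bnd: "- 1 < sin (\<alpha> u) / sqrt m" "sin (\<alpha> u) / sqrt m < 1" for u
    using sq[of u] abs_square_less_1[of "sin (\<alpha> u) / sqrt m"] by linarith+
  have sin\<theta>: "sin (\<theta> u) = sin (\<alpha> u) / sqrt m" for u
    unfolding \<theta>_def using bnd[of u] by simp
  have cos\<theta>: "cos (\<theta> u) = D u" for u
    unfolding \<theta>_def D_def using bnd[of u] assms(1) by (simp add: cos_arcsin power_divide)
  have Dnz: "D u > 0" for u using pos[of u] by (simp add: D_def)
  have \<theta>': "(\<theta> has_real_derivative cos (\<alpha> u)) (at u)" for u
  proof -
    have "((\<lambda>u. sin (\<alpha> u) / sqrt m) has_real_derivative cos (\<alpha> u) * D u) (at u)"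
      using assms(1) by (auto intro!: derivative_eq_intros \<alpha>' simp: mult.assoc)
    then have "((\<lambda>u. arcsin (sin (\<alpha> u) / sqrt m)) has_real_derivative
        inverse (sqrt (1 - (sin (\<alpha> u) / sqrt m)\<^sup>2)) * (cos (\<alpha> u) * D u)) (at u)"
      using bnd by (intro DERIV_chain2[of arcsin] DERIV_arcsin)
    moreover have "sqrt (1 - (sin (\<alpha> u) / sqrt m)\<^sup>2) = D u"
      using assms(1) by (simp add: D_def power_divide)
    moreover have "inverse (D u) * (cos (\<alpha> u) * D u) = cos (\<alpha> u)"
      using Dnz[of u] by simp
    ultimately show ?thesis
      unfolding \<theta>_def[abs_def] by simp
  qed
  have "((\<lambda>u. cos (\<alpha> u)) has_real_derivative - m * sin (\<theta> u) * cos (\<theta> u)) (at u)" for u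
    unfolding sin\<theta> cos\<theta> using assms(1)
    by (auto intro!: derivative_eq_intros \<alpha>' simp: field_simps)
  moreover have "\<theta> 0 = 0" "cos (\<alpha> 0) = 1"
    using jacobi_am_zero[OF \<mu>] by (simp_all add: \<theta>_def \<alpha>_def)
  ultimately have "is_jacobi_am m \<theta>"
    unfolding is_jacobi_am_def using \<theta>' by (intro exI[of _ "\<lambda>u. cos (\<alpha> u)"]) auto
  then have am: "(\<lambda>u. jacobi_am u m) = \<theta>" using jacobi_am_eqI by blast
  show "jacobi_sn u m = sin (\<alpha> u) / sqrt m"
    using sin\<theta> am by (simp add: jacobi_sn_def fun_eq_iff)
  show "jacobi_cn u m = sqrt (1 - 1 / m * (sin (\<alpha> u))\<^sup>2)"
    using cos\<theta> am by (simp add: jacobi_cn_def fun_eq_iff D_def)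
  show "jacobi_dn u m = cos (\<alpha> u)"
    unfolding jacobi_dn_def am by (rule DERIV_imp_deriv[OF \<theta>'])
qed

section \<open>Smooth maps\<close>

text \<open>Smoothness as a greatest fixed point: a class of differentiable functions that is closed under
directional derivatives consists of smooth functions.\<close>

lemma smooth_coinduct:
  assumes "f \<in> \<F>"
    and diff: "\<And>g p. g \<in> \<F> \<Longrightarrow> g differentiable (at p)"
    and deriv: "\<And>g v. g \<in> \<F> \<Longrightarrow> (\<lambda>p. frechet_derivative g (at p) v) \<in> \<F>"
  shows "smooth f"
proof -
  have "g \<in> \<F> \<Longrightarrow> C_k k g" for k g
  proof (induction k arbitrary: g)
    case 0
    then show ?case
      using diff[OF 0] by (auto intro!: continuous_at_imp_continuous_on differentiable_imp_continuous_within)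
  next
    case (Suc k)
    then show ?case using diff deriv by auto
  qed
  with assms(1) show ?thesis by (simp add: smooth_def)
qed

lemma smooth_has_derivative:
  assumes "smooth f" shows "(f has_derivative frechet_derivative f (at p)) (at p)"
proof -
  have "C_k 1 f" using assms by (simp add: smooth_def)
  then show ?thesis by (simp add: frechet_derivative_works)
qed

lemma smooth_directional_derivative:
  assumes "smooth f" shows "smooth (\<lambda>p. frechet_derivative f (at p) v)"
  unfolding smooth_def
proof
  fix k
  have "C_k (Suc k) f" using assms by (simp add: smooth_def)
  then show "C_k k (\<lambda>p. frechet_derivative f (at p) v)" by simp
qed

lemma smooth_continuous_on: "smooth f \<Longrightarrow> continuous_on A f"
  by (metis C_k.simps(1) continuous_on_subset smooth_def subset_UNIV)

text \<open>The algebra of functions generated by a set. If directional derivatives of the generators stay in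
the algebra, the Leibniz rule extends this to the whole algebra, and \<open>smooth_coinduct\<close> applies.\<close>

inductive_set algebra_generated :: "('a \<Rightarrow> real) set \<Rightarrow> ('a \<Rightarrow> real) set" for B where
  base: "b \<in> B \<Longrightarrow> b \<in> algebra_generated B"
| const: "(\<lambda>p. c) \<in> algebra_generated B"
| add: "f \<in> algebra_generated B \<Longrightarrow> g \<in> algebra_generated B \<Longrightarrow> (\<lambda>p. f p + g p) \<in> algebra_generated B"
| mult: "f \<in> algebra_generated B \<Longrightarrow> g \<in> algebra_generated B \<Longrightarrow> (\<lambda>p. f p * g p) \<in> algebra_generated B"

lemma algebra_generated_diff:
  assumes "f \<in> algebra_generated B" "g \<in> algebra_generated B"
  shows "(\<lambda>p. f p - g p) \<in> algebra_generated B"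
  using algebra_generated.add[OF assms(1) algebra_generated.mult[OF algebra_generated.const[of "- 1"] assms(2)]]
  by simp

lemma algebra_generated_uminus:
  assumes "f \<in> algebra_generated B" shows "(\<lambda>p. - f p) \<in> algebra_generated B"
  using algebra_generated.mult[OF algebra_generated.const[of "- 1"] assms] by simp

definition derivation_closed :: "('a::euclidean_space \<Rightarrow> real) set \<Rightarrow> bool" where
  "derivation_closed B \<longleftrightarrow> (\<forall>b\<in>B. \<exists>b'. (\<forall>p. (b has_derivative b' p) (at p)) \<and>
     (\<forall>v. (\<lambda>p. b' p v) \<in> algebra_generated B))"

lemma derivation_closed_algebra:
  assumes "derivation_closed B" "f \<in> algebra_generated B"
  obtains f' where "\<And>p. (f has_derivative f' p) (at p)" "\<And>v. (\<lambda>p. f' p v) \<in> algebra_generated B"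
proof -
  have "\<exists>f'. (\<forall>p. (f has_derivative f' p) (at p)) \<and> (\<forall>v. (\<lambda>p. f' p v) \<in> algebra_generated B)"
    using assms(2)
  proof induction
    case (base b)
    with assms(1) show ?case unfolding derivation_closed_def by blast
  next
    case (const c)
    show ?case
      by (intro exI[of _ "\<lambda>p v. 0"]) (auto intro: algebra_generated.const)
  next
    case (add f g)
    then obtain f' g' where "\<And>p. (f has_derivative f' p) (at p)" "\<And>v. (\<lambda>p. f' p v) \<in> algebra_generated B"
      "\<And>p. (g has_derivative g' p) (at p)" "\<And>v. (\<lambda>p. g' p v) \<in> algebra_generated B" by blast
    then show ?case
      by (intro exI[of _ "\<lambda>p v. f' p v + g' p v"])
        (auto intro!: has_derivative_add algebra_generated.add)
  next
    case (mult f g)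
    then obtain f' g' where "\<And>p. (f has_derivative f' p) (at p)" "\<And>v. (\<lambda>p. f' p v) \<in> algebra_generated B"
      "\<And>p. (g has_derivative g' p) (at p)" "\<And>v. (\<lambda>p. g' p v) \<in> algebra_generated B" by blast
    with mult.hyps show ?case
      by (intro exI[of _ "\<lambda>p v. f p * g' p v + f' p v * g p"])
        (auto intro!: has_derivative_mult algebra_generated.add algebra_generated.mult)
  qed
  with that show ?thesis by blast
qed

lemma smooth_algebra_generated:
  assumes "derivation_closed B" "f \<in> algebra_generated B"
  shows "smooth f"
proof (rule smooth_coinduct[of _ "algebra_generated B"])
  fix g p v assume g: "g \<in> algebra_generated B"
  obtain g' where g': "\<And>p. (g has_derivative g' p) (at p)" "\<And>v. (\<lambda>p. g' p v) \<in> algebra_generated B"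
    using derivation_closed_algebra[OF assms(1) g] by blast
  show "g differentiable at p" using g'(1) by (auto simp: differentiable_def)
  have "frechet_derivative g (at p) = g' p" for p using g'(1) frechet_derivative_at by metis
  then show "(\<lambda>p. frechet_derivative g (at p) v) \<in> algebra_generated B" using g'(2) by simp
qed (rule assms(2))

lemma vector3_axis:
  "(vector [a, b, c] :: real ^ 3) = a *\<^sub>R axis 1 1 + b *\<^sub>R axis 2 1 + c *\<^sub>R axis 3 1"
  by (simp add: vec_eq_iff forall_3 axis_def)

lemma has_derivative_vector3:
  assumes "(f1 has_derivative f1') F" "(f2 has_derivative f2') F" "(f3 has_derivative f3') F"
  shows "((\<lambda>p. vector [f1 p, f2 p, f3 p] :: real ^ 3) has_derivative (\<lambda>v. vector [f1' v, f2' v, f3' v])) F"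
  unfolding vector3_axis
  by (intro has_derivative_add has_derivative_scaleR_left assms)

lemma smooth_vector3_algebra_generated:
  assumes "derivation_closed B"
    and "f1 \<in> algebra_generated B" "f2 \<in> algebra_generated B" "f3 \<in> algebra_generated B"
  shows "smooth (\<lambda>p. vector [f1 p, f2 p, f3 p] :: real ^ 3)"
proof (rule smooth_coinduct[of _ "{\<lambda>p. vector [f1 p, f2 p, f3 p] | f1 f2 f3.
    f1 \<in> algebra_generated B \<and> f2 \<in> algebra_generated B \<and> f3 \<in> algebra_generated B}"])
  fix g :: "'a \<Rightarrow> real ^ 3" and p v
  assume "g \<in> {\<lambda>p. vector [f1 p, f2 p, f3 p] | f1 f2 f3.
    f1 \<in> algebra_generated B \<and> f2 \<in> algebra_generated B \<and> f3 \<in> algebra_generated B}"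
  then obtain f1 f2 f3 where g: "g = (\<lambda>p. vector [f1 p, f2 p, f3 p])"
    and f: "f1 \<in> algebra_generated B" "f2 \<in> algebra_generated B" "f3 \<in> algebra_generated B" by blast
  obtain f1' where 1: "\<And>p. (f1 has_derivative f1' p) (at p)" "\<And>v. (\<lambda>p. f1' p v) \<in> algebra_generated B"
    using derivation_closed_algebra[OF assms(1) f(1)] by blast
  obtain f2' where 2: "\<And>p. (f2 has_derivative f2' p) (at p)" "\<And>v. (\<lambda>p. f2' p v) \<in> algebra_generated B"
    using derivation_closed_algebra[OF assms(1) f(2)] by blast
  obtain f3' where 3: "\<And>p. (f3 has_derivative f3' p) (at p)" "\<And>v. (\<lambda>p. f3' p v) \<in> algebra_generated B"
    using derivation_closed_algebra[OF assms(1) f(3)] by blast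
  have g': "(g has_derivative (\<lambda>v. vector [f1' p v, f2' p v, f3' p v])) (at p)" for p
    unfolding g by (intro has_derivative_vector3 1 2 3)
  then show "g differentiable at p" by (auto simp: differentiable_def)
  have "frechet_derivative g (at p) = (\<lambda>v. vector [f1' p v, f2' p v, f3' p v])" for p
    using g' frechet_derivative_at by metis
  then show "(\<lambda>p. frechet_derivative g (at p) v) \<in> {\<lambda>p. vector [f1 p, f2 p, f3 p] | f1 f2 f3.
    f1 \<in> algebra_generated B \<and> f2 \<in> algebra_generated B \<and> f3 \<in> algebra_generated B}"
    using 1(2)[of v] 2(2)[of v] 3(2)[of v]
    by (intro CollectI exI[of _ "\<lambda>p. f1' p v"] exI[of _ "\<lambda>p. f2' p v"] exI[of _ "\<lambda>p. f3' p v"] conjI) simp_all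
qed (use assms in blast)

lemma has_vector_derivative_along_line:
  assumes "(f has_derivative f') (at (p + x *\<^sub>R v))"
  shows "((\<lambda>x. f (p + x *\<^sub>R v)) has_vector_derivative f' v) (at x within A)"
proof -
  have "((\<lambda>x. p + x *\<^sub>R v) has_vector_derivative v) (at x within A)"
    by (auto intro!: derivative_eq_intros simp: has_vector_derivative_def)
  then have "((\<lambda>x. f (p + x *\<^sub>R v)) has_derivative (\<lambda>h. f' (h *\<^sub>R v))) (at x within A)"
    unfolding has_vector_derivative_def using assms by (rule has_derivative_compose)
  moreover have "f' (h *\<^sub>R v) = h *\<^sub>R f' v" for h
    using assms has_derivative_bounded_linear bounded_linear.linear linear_scale by blast
  ultimately show ?thesis by (simp add: has_vector_derivative_def)
qed

text \<open>Integrating the derivative in the first direction recovers the increments of \<open>f\<close>. Differentiating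
under the integral sign in the second direction and then applying the fundamental theorem of
calculus in the first one exchanges the two derivatives.\<close>

lemma smooth_mixed_partials:
  fixes f :: "real \<times> real \<Rightarrow> 'b::euclidean_space"
  assumes "smooth f"
  shows "frechet_derivative (\<lambda>p. frechet_derivative f (at p) (1, 0)) (at q) (0, 1)
       = frechet_derivative (\<lambda>p. frechet_derivative f (at p) (0, 1)) (at q) (1, 0)"
proof -
  obtain a b where q: "q = (a, b)" by (cases q)
  define fs where "fs p = frechet_derivative f (at p) (1, 0)" for p
  define ft where "ft p = frechet_derivative f (at p) (0, 1)" for p
  define fst' where "fst' p = frechet_derivative fs (at p) (0, 1)" for p
  define fts' where "fts' p = frechet_derivative ft (at p) (1, 0)" for p
  have smfs: "smooth fs" and smft: "smooth ft"
    unfolding fs_def ft_def by (rule smooth_directional_derivative[OF assms])+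
  have smfst: "smooth fst'"
    unfolding fst'_def by (rule smooth_directional_derivative[OF smfs])
  have Ds: "((\<lambda>s. f (s, t)) has_vector_derivative fs (s, t)) (at s within A)" for s t A
    using has_vector_derivative_along_line[of f _ "(0, t)" s "(1, 0)" A] smooth_has_derivative[OF assms, of "(s, t)"]
    by (simp add: fs_def)
  have Dt: "((\<lambda>t. f (s, t)) has_vector_derivative ft (s, t)) (at t within A)" for s t A
    using has_vector_derivative_along_line[of f _ "(s, 0)" t "(0, 1)" A] smooth_has_derivative[OF assms, of "(s, t)"]
    by (simp add: ft_def)
  have Dst: "((\<lambda>t. fs (s, t)) has_vector_derivative fst' (s, t)) (at t within A)" for s t A
    using has_vector_derivative_along_line[of fs _ "(s, 0)" t "(0, 1)" A] smooth_has_derivative[OF smfs, of "(s, t)"]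
    by (simp add: fst'_def)
  have Dts: "((\<lambda>s. ft (s, t)) has_vector_derivative fts' (s, t)) (at s within A)" for s t A
    using has_vector_derivative_along_line[of ft _ "(0, t)" s "(1, 0)" A] smooth_has_derivative[OF smft, of "(s, t)"]
    by (simp add: fts'_def)
  \<comment> \<open>Any base point to the left of \<open>a\<close> serves, so that \<open>a\<close> is interior to \<open>{c..a + 1}\<close>.\<close>
  define c where "c = a - 1"
  have ca: "c \<le> a" by (simp add: c_def)
  have int: "((\<lambda>\<sigma>. fs (\<sigma>, t)) has_integral f (s, t) - f (c, t)) (cbox c s)" if "c \<le> s" for s t
    unfolding cbox_interval by (rule fundamental_theorem_of_calculus[OF that Ds])
  have key: "integral {c..s} (\<lambda>\<sigma>. fst' (\<sigma>, b)) = ft (s, b) - ft (c, b)" if s: "c \<le> s" for s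
  proof -
    have "((\<lambda>t. integral (cbox c s) (\<lambda>\<sigma>. fs (\<sigma>, t))) has_vector_derivative
        integral (cbox c s) (\<lambda>\<sigma>. fst' (\<sigma>, b))) (at b within UNIV)"
    proof (rule leibniz_rule_vector_derivative)
      show "continuous_on (UNIV \<times> cbox c s) (\<lambda>(t, \<sigma>). fst' (\<sigma>, t))"
        unfolding case_prod_unfold
        by (intro continuous_on_compose2[OF smooth_continuous_on[OF smfst, of UNIV]] continuous_intros) auto
      show "(\<lambda>\<sigma>. fs (\<sigma>, t)) integrable_on cbox c s" for t
        using int[OF s] by blast
    qed (use Dst in auto)
    moreover have "((\<lambda>t. f (s, t) - f (c, t)) has_vector_derivative ft (s, b) - ft (c, b)) (at b)"
      by (intro has_vector_derivative_diff Dt)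
    moreover have "integral (cbox c s) (\<lambda>\<sigma>. fs (\<sigma>, t)) = f (s, t) - f (c, t)" for t
      using int[OF s] by (rule integral_unique)
    ultimately show ?thesis by (auto dest: vector_derivative_unique_at)
  qed
  have "((\<lambda>s. integral {c..s} (\<lambda>\<sigma>. fst' (\<sigma>, b))) has_vector_derivative fst' (a, b)) (at a within {c..a + 1})"
    by (rule integral_has_vector_derivative)
      (auto simp: c_def intro!: continuous_on_compose2[OF smooth_continuous_on[OF smfst, of UNIV]] continuous_intros)
  then have "((\<lambda>s. ft (s, b) - ft (c, b)) has_vector_derivative fst' (a, b)) (at a within {c..a + 1})"
    by (rule has_vector_derivative_transform[rotated 2]) (auto simp: key ca)
  moreover have "((\<lambda>s. ft (s, b) - ft (c, b)) has_vector_derivative fts' (a, b) - 0) (at a within {c..a + 1})"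
    by (intro has_vector_derivative_diff Dts has_vector_derivative_const)
  ultimately have "fst' (a, b) = fts' (a, b)"
    using at_within_interior[of a "{c..a + 1}"] by (auto simp: c_def dest: vector_derivative_unique_at)
  then show ?thesis by (simp add: q fst'_def fts'_def fs_def[abs_def] ft_def[abs_def])
qed

section \<open>Uniqueness of pseudospherical maps\<close>

text \<open>The determinant of an orthogonal matrix is \<open>1\<close> or \<open>- 1\<close>, and the orientation excludes \<open>- 1\<close>.\<close>

lemma rotation_matrix_frame:
  assumes "oriented_orthonormal a b c"
  shows "rotation_matrix (vector [a, b, c] :: real ^ 3 ^ 3)"
proof -
  let ?M = "vector [a, b, c] :: real ^ 3 ^ 3"
  have "row 1 ?M = a" "row 2 ?M = b" "row 3 ?M = c"
    by (simp_all add: row_def vec_eq_iff)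
  then have "orthogonal_matrix ?M"
    using assms unfolding orthogonal_matrix_orthonormal_rows
    by (simp add: forall_3 orthogonal_def oriented_orthonormal_def inner_commute)
  moreover from this have "det ?M = 1"
    using assms det_orthogonal_matrix[of ?M] by (auto simp: oriented_orthonormal_def)
  ultimately show ?thesis by (simp add: rotation_matrix_def)
qed

lemma frame_matrix_mult_vec:
  "(vector [a, b, c] :: real ^ 3 ^ 3) *v x = vector [inner a x, inner b x, inner c x]"
  by (simp add: vec_eq_iff forall_3 matrix_vector_mult_def inner_vec_def)

lemma vec_mult_frame_matrix:
  "vector [x, y, z] v* (vector [a, b, c] :: real ^ 3 ^ 3) = x *\<^sub>R a + y *\<^sub>R b + z *\<^sub>R c"
  by (simp add: vec_eq_iff forall_3 vector_matrix_mult_def sum_3 algebra_simps)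

lemma oriented_orthonormal_expansion:
  assumes "oriented_orthonormal a b c"
  shows "x = inner x a *\<^sub>R a + inner x b *\<^sub>R b + inner x c *\<^sub>R c"
proof -
  let ?M = "vector [a, b, c] :: real ^ 3 ^ 3"
  have "transpose ?M ** ?M = mat 1"
    using rotation_matrix_frame[OF assms] by (simp add: rotation_matrix_def orthogonal_matrix_def)
  then have "x = transpose ?M *v (?M *v x)"
    by (simp add: matrix_vector_mul_assoc)
  then show ?thesis
    by (simp add: frame_matrix_mult_vec vec_mult_frame_matrix inner_commute)
qed

lemma oriented_orthonormal_inner:
  assumes "oriented_orthonormal a b c"
  shows "inner a a = 1" "inner b b = 1" "inner c c = 1"
    "inner a b = 0" "inner b a = 0" "inner a c = 0" "inner c a = 0" "inner b c = 0" "inner c b = 0"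
  using assms by (auto simp: oriented_orthonormal_def inner_commute norm_eq_1)

lemma rotation_between_frames:
  assumes "oriented_orthonormal a b c" "oriented_orthonormal a' b' c'"
  obtains A where "rotation_matrix A" "A *v a = a'" "A *v b = b'" "A *v c = c'"
proof
  let ?M = "vector [a, b, c] :: real ^ 3 ^ 3" and ?N = "vector [a', b', c'] :: real ^ 3 ^ 3"
  show "rotation_matrix (transpose ?N ** ?M)"
    using rotation_matrix_frame[OF assms(1)] rotation_matrix_frame[OF assms(2)]
    by (simp add: rotation_matrix_def orthogonal_matrix_mul orthogonal_matrix_transpose det_mul det_transpose)
  show "(transpose ?N ** ?M) *v a = a'" "(transpose ?N ** ?M) *v b = b'" "(transpose ?N ** ?M) *v c = c'"
    by (simp_all add: frame_matrix_mult_vec vec_mult_frame_matrix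
        oriented_orthonormal_inner[OF assms(1)] flip: matrix_vector_mul_assoc)
qed

text \<open>Source of the skew symmetry of the connection coefficients of an orthonormal frame.\<close>

lemma inner_derivative_const:
  assumes "\<And>p. inner (f p) (g p) = c"
    and "(f has_derivative f') (at p)" "(g has_derivative g') (at p)"
  shows "inner (f' v) (g p) = - inner (g' v) (f p)"
proof -
  have "((\<lambda>p. inner (f p) (g p)) has_derivative (\<lambda>v. inner (f p) (g' v) + inner (f' v) (g p))) (at p)"
    by (rule has_derivative_inner assms)+
  moreover have "((\<lambda>p. inner (f p) (g p)) has_derivative (\<lambda>v. 0)) (at p)"
    unfolding assms(1) by (rule has_derivative_const)
  ultimately have "inner (f p) (g' v) + inner (f' v) (g p) = 0"
    by (rule fun_cong[OF has_derivative_unique])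
  then show ?thesis by (simp add: inner_commute)
qed

text \<open>A moving orthonormal frame has only three independent connection coefficients; the others follow by
skew symmetry.\<close>

lemma frame_derivative:
  assumes frame: "\<And>p. oriented_orthonormal (e1 p) (e2 p) (e3 p)"
    and D: "(e1 has_derivative e1') (at p)" "(e2 has_derivative e2') (at p)" "(e3 has_derivative e3') (at p)"
  shows "e1' v = inner (e1' v) (e2 p) *\<^sub>R e2 p + inner (e1' v) (e3 p) *\<^sub>R e3 p"
    and "e2' v = - inner (e1' v) (e2 p) *\<^sub>R e1 p + inner (e2' v) (e3 p) *\<^sub>R e3 p"
    and "e3' v = - inner (e1' v) (e3 p) *\<^sub>R e1 p - inner (e2' v) (e3 p) *\<^sub>R e2 p"
proof -
  note in_frame = oriented_orthonormal_inner[OF frame]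
  have 0: "inner (e1' v) (e1 p) = 0" "inner (e2' v) (e2 p) = 0" "inner (e3' v) (e3 p) = 0"
    using inner_derivative_const[OF in_frame(1) D(1) D(1)] inner_derivative_const[OF in_frame(2) D(2) D(2)]
      inner_derivative_const[OF in_frame(3) D(3) D(3)]
    by (metis add.inverse_neutral equal_neg_zero)+
  have anti: "inner (e2' v) (e1 p) = - inner (e1' v) (e2 p)" "inner (e3' v) (e1 p) = - inner (e1' v) (e3 p)"
    "inner (e3' v) (e2 p) = - inner (e2' v) (e3 p)"
    using inner_derivative_const[OF in_frame(4) D(1) D(2)] inner_derivative_const[OF in_frame(6) D(1) D(3)]
      inner_derivative_const[OF in_frame(8) D(2) D(3)] by simp_all
  show "e1' v = inner (e1' v) (e2 p) *\<^sub>R e2 p + inner (e1' v) (e3 p) *\<^sub>R e3 p"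
    "e2' v = - inner (e1' v) (e2 p) *\<^sub>R e1 p + inner (e2' v) (e3 p) *\<^sub>R e3 p"
    "e3' v = - inner (e1' v) (e3 p) *\<^sub>R e1 p - inner (e2' v) (e3 p) *\<^sub>R e2 p"
    using oriented_orthonormal_expansion[OF frame[of p], of "e1' v"]
      oriented_orthonormal_expansion[OF frame[of p], of "e2' v"]
      oriented_orthonormal_expansion[OF frame[of p], of "e3' v"]
    by (simp_all add: 0 anti)
qed

lemma eq_of_norm_one_inner_one:
  fixes x y :: "'a::real_inner"
  assumes "norm x = 1" "norm y = 1" "inner x y = 1" shows "x = y"
proof -
  have "inner (x - y) (x - y) = 0"
    using assms by (simp add: inner_diff_left inner_diff_right inner_commute norm_eq_1)
  then show ?thesis by simp
qed

text \<open>After rotating the first frame so that the two agree at the origin, the sum \<open>G\<close> of the three inner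
products of corresponding vectors has derivative zero, because the common connection matrix is skew
symmetric. Hence \<open>G = 3\<close> throughout, and equality in the Cauchy-Schwarz inequality identifies the
frames.\<close>

lemma frames_congruent:
  fixes e1 e2 e3 d1 d2 d3 :: "'a::euclidean_space \<Rightarrow> real ^ 3"
  assumes frame_e: "\<And>p. oriented_orthonormal (e1 p) (e2 p) (e3 p)"
    and frame_d: "\<And>p. oriented_orthonormal (d1 p) (d2 p) (d3 p)"
    and De: "\<And>p. (e1 has_derivative e1' p) (at p)" "\<And>p. (e2 has_derivative e2' p) (at p)"
      "\<And>p. (e3 has_derivative e3' p) (at p)"
    and Dd: "\<And>p. (d1 has_derivative d1' p) (at p)" "\<And>p. (d2 has_derivative d2' p) (at p)"
      "\<And>p. (d3 has_derivative d3' p) (at p)"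
    and conn: "\<And>p v. inner (e1' p v) (e2 p) = inner (d1' p v) (d2 p)"
      "\<And>p v. inner (e1' p v) (e3 p) = inner (d1' p v) (d3 p)"
      "\<And>p v. inner (e2' p v) (e3 p) = inner (d2' p v) (d3 p)"
  obtains A where "rotation_matrix A"
    "\<And>p. d1 p = A *v e1 p" "\<And>p. d2 p = A *v e2 p" "\<And>p. d3 p = A *v e3 p"
proof -
  obtain A where A: "rotation_matrix A" "A *v e1 0 = d1 0" "A *v e2 0 = d2 0" "A *v e3 0 = d3 0"
    using rotation_between_frames[OF frame_e[of 0] frame_d[of 0]] by blast
  define G where "G p = inner (A *v e1 p) (d1 p) + inner (A *v e2 p) (d2 p) + inner (A *v e3 p) (d3 p)" for p
  have neg: "A *v (- x) = - (A *v x)" for x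
    by (rule linear_neg[OF matrix_vector_mul_linear])
  have "(G has_derivative (\<lambda>v. 0)) (at p)" for p
  proof -
    have lin: "bounded_linear ((*v) A)" by (rule matrix_vector_mul_bounded_linear)
    have "(G has_derivative (\<lambda>v. (inner (A *v e1 p) (d1' p v) + inner (A *v e1' p v) (d1 p))
        + (inner (A *v e2 p) (d2' p v) + inner (A *v e2' p v) (d2 p))
        + (inner (A *v e3 p) (d3' p v) + inner (A *v e3' p v) (d3 p)))) (at p)"
      unfolding G_def
      by (intro has_derivative_add has_derivative_inner De Dd bounded_linear.has_derivative[OF lin])
    moreover have "(inner (A *v e1 p) (d1' p v) + inner (A *v e1' p v) (d1 p))
        + (inner (A *v e2 p) (d2' p v) + inner (A *v e2' p v) (d2 p))
        + (inner (A *v e3 p) (d3' p v) + inner (A *v e3' p v) (d3 p)) = 0" for v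
      by (subst frame_derivative[OF frame_e De], subst frame_derivative(2)[OF frame_e De],
          subst frame_derivative(3)[OF frame_e De], subst frame_derivative[OF frame_d Dd],
          subst frame_derivative(2)[OF frame_d Dd], subst frame_derivative(3)[OF frame_d Dd])
        (simp add: conn neg matrix_vector_right_distrib matrix_vector_mult_diff_distrib matrix_vector_mult_scaleR
          inner_add_left inner_add_right inner_diff_left inner_diff_right algebra_simps)
    ultimately show ?thesis by simp
  qed
  then have G0: "G p = G 0" for p
    using has_derivative_zero_constant[of UNIV G] by auto
  have isom: "norm (A *v x) = norm x" for x
    using A(1) orthogonal_transformation_matrix[of "(*v) A"]
    by (simp add: rotation_matrix_def orthogonal_transformation)
  have n: "norm (e1 p) = 1" "norm (e2 p) = 1" "norm (e3 p) = 1" "norm (d1 p) = 1" "norm (d2 p) = 1" "norm (d3 p) = 1" for p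
    using frame_e[of p] frame_d[of p] by (auto simp: oriented_orthonormal_def)
  have "G 0 = 3"
    using oriented_orthonormal_inner[OF frame_d[of 0]] by (simp add: G_def A)
  then have "inner (A *v e1 p) (d1 p) + inner (A *v e2 p) (d2 p) + inner (A *v e3 p) (d3 p) = 3" for p
    using G0[of p] by (simp add: G_def)
  moreover have "inner (A *v e1 p) (d1 p) \<le> 1" "inner (A *v e2 p) (d2 p) \<le> 1" "inner (A *v e3 p) (d3 p) \<le> 1" for p
    using norm_cauchy_schwarz[of "A *v e1 p" "d1 p"] norm_cauchy_schwarz[of "A *v e2 p" "d2 p"]
      norm_cauchy_schwarz[of "A *v e3 p" "d3 p"] by (simp_all add: isom n)
  ultimately have one: "inner (A *v e1 p) (d1 p) = 1" "inner (A *v e2 p) (d2 p) = 1" "inner (A *v e3 p) (d3 p) = 1" for p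
    by (smt (verit))+
  show ?thesis
  proof (rule that[OF A(1)])
    show "d1 p = A *v e1 p" "d2 p = A *v e2 p" "d3 p = A *v e3 p" for p
      using eq_of_norm_one_inner_one[OF _ n(4) one(1)] eq_of_norm_one_inner_one[OF _ n(5) one(2)]
        eq_of_norm_one_inner_one[OF _ n(6) one(3)] isom n by metis+
  qed
qed

text \<open>The body of \<open>is_pseudospherical_map\<close> with the adapted frame made explicit, so that facts about the
frame can be stated.\<close>

definition pseudospherical_frame :: "(real \<times> real \<Rightarrow> real) \<Rightarrow> (real \<times> real \<Rightarrow> real ^ 3) \<Rightarrow>
    (real \<times> real \<Rightarrow> real ^ 3) \<Rightarrow> (real \<times> real \<Rightarrow> real ^ 3) \<Rightarrow> (real \<times> real \<Rightarrow> real ^ 3) \<Rightarrow> bool" where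
  "pseudospherical_frame \<phi> f e1 e2 e3 \<longleftrightarrow> smooth f \<and> smooth e1 \<and> smooth e2 \<and> smooth e3 \<and>
        (\<forall>p. oriented_orthonormal (e1 p) (e2 p) (e3 p)) \<and>
        (\<forall>p. frechet_derivative f (at p) (1, 0) = cos (\<phi> p / 2) *\<^sub>R e1 p) \<and>
        (\<forall>p. frechet_derivative f (at p) (0, 1) = sin (\<phi> p / 2) *\<^sub>R e2 p) \<and>
        (\<forall>p. (\<forall>k::int. \<phi> p \<noteq> of_int k * pi) \<longrightarrow>
           (\<forall>a b. - inner (frechet_derivative f (at p) (a, b)) (frechet_derivative e3 (at p) (a, b))
                  = cos (\<phi> p / 2) * sin (\<phi> p / 2) * (a\<^sup>2 - b\<^sup>2)))"

lemma is_pseudospherical_map_iff_frame: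
  "is_pseudospherical_map \<phi> f \<longleftrightarrow> (\<exists>e1 e2 e3. pseudospherical_frame \<phi> f e1 e2 e3)"
  unfolding is_pseudospherical_map_def pseudospherical_frame_def by auto

lemma linear_plane: "linear L \<Longrightarrow> L (a, b) = a *\<^sub>R L (1, 0) + b *\<^sub>R L (0, 1)"
  for L :: "real \<times> real \<Rightarrow> 'b::real_vector"
  using linear_add[of L "a *\<^sub>R (1, 0)" "b *\<^sub>R (0, 1)"]
    linear_scale[of L a "(1, 0)"] linear_scale[of L b "(0, 1)"] by simp

lemma smooth_frechet_plane:
  fixes f :: "real \<times> real \<Rightarrow> 'b::euclidean_space"
  assumes "smooth f"
  shows "frechet_derivative f (at p) (a, b) =
    a *\<^sub>R frechet_derivative f (at p) (1, 0) + b *\<^sub>R frechet_derivative f (at p) (0, 1)"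
  by (rule linear_plane) (use smooth_has_derivative[OF assms] has_derivative_linear in blast)

text \<open>Write \<open>c, s\<close> for \<open>cos (\<phi>/2), sin (\<phi>/2)\<close>, both nonzero here. Comparing coefficients in the second
fundamental form gives the coefficients involving \<open>e3\<close> along the coordinate directions and one
relation between the two mixed ones. The equation \<open>\<partial>\<^sub>t (c e1) = \<partial>\<^sub>s (s e2)\<close> supplies a second
relation between the mixed ones through its \<open>e3\<close> component, and the coefficients
\<open>\<langle>de1, e2\<rangle>\<close> through the other components.\<close>

lemma structure_equations_at_regular_point:
  assumes frame: "pseudospherical_frame \<phi> f e1 e2 e3" and "smooth \<phi>"
    and reg: "\<forall>k::int. \<phi> p \<noteq> of_int k * pi"
  shows "inner (frechet_derivative e1 (at p) (1, 0)) (e2 p) = frechet_derivative \<phi> (at p) (0, 1) / 2"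
    and "inner (frechet_derivative e1 (at p) (0, 1)) (e2 p) = frechet_derivative \<phi> (at p) (1, 0) / 2"
    and "inner (frechet_derivative e1 (at p) (1, 0)) (e3 p) = sin (\<phi> p / 2)"
    and "inner (frechet_derivative e1 (at p) (0, 1)) (e3 p) = 0"
    and "inner (frechet_derivative e2 (at p) (1, 0)) (e3 p) = 0"
    and "inner (frechet_derivative e2 (at p) (0, 1)) (e3 p) = - cos (\<phi> p / 2)"
proof -
  define c s where "c = cos (\<phi> p / 2)" and "s = sin (\<phi> p / 2)"
  have sm: "smooth f" "smooth e1" "smooth e2" "smooth e3"
    and on: "\<And>p. oriented_orthonormal (e1 p) (e2 p) (e3 p)"
    and fs: "\<And>p. frechet_derivative f (at p) (1, 0) = cos (\<phi> p / 2) *\<^sub>R e1 p"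
    and ft: "\<And>p. frechet_derivative f (at p) (0, 1) = sin (\<phi> p / 2) *\<^sub>R e2 p"
    and II: "\<And>a b. - inner (frechet_derivative f (at p) (a, b)) (frechet_derivative e3 (at p) (a, b))
                  = c * s * (a\<^sup>2 - b\<^sup>2)"
    using frame reg unfolding pseudospherical_frame_def c_def s_def by blast+
  note D = smooth_has_derivative[OF sm(2), of p] smooth_has_derivative[OF sm(3), of p] smooth_has_derivative[OF sm(4), of p]
  note \<phi>' = smooth_has_derivative[OF \<open>smooth \<phi>\<close>, of p]
  note on1 = oriented_orthonormal_inner[OF on]
  have "sin (\<phi> p) \<noteq> 0"
    using reg by (simp add: sin_zero_iff_int2)
  moreover have "sin (\<phi> p) = 2 * s * c"
    using sin_double[of "\<phi> p / 2"] by (simp add: c_def s_def)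
  ultimately have nz: "c \<noteq> 0" "s \<noteq> 0" by auto
  let ?d1 = "frechet_derivative e1 (at p)" and ?d2 = "frechet_derivative e2 (at p)"
    and ?d3 = "frechet_derivative e3 (at p)"
  have anti: "inner (e1 p) (?d3 v) = - inner (?d1 v) (e3 p)" "inner (e2 p) (?d3 v) = - inner (?d2 v) (e3 p)"
    "inner (?d2 v) (e1 p) = - inner (?d1 v) (e2 p)" "inner (?d1 v) (e1 p) = 0" "inner (?d2 v) (e2 p) = 0" for v
    using inner_derivative_const[OF on1(6) D(1) D(3), of v] inner_derivative_const[OF on1(8) D(2) D(3), of v]
      inner_derivative_const[OF on1(4) D(1) D(2), of v] inner_derivative_const[OF on1(1) D(1) D(1), of v]
      inner_derivative_const[OF on1(2) D(2) D(2), of v] by (simp_all add: inner_commute)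
  have II': "inner ((a * c) *\<^sub>R e1 p + (b * s) *\<^sub>R e2 p) (a *\<^sub>R ?d3 (1, 0) + b *\<^sub>R ?d3 (0, 1))
      = - (c * s * (a\<^sup>2 - b\<^sup>2))" for a b
    using II[of a b] by (simp add: smooth_frechet_plane[OF sm(1), of p a b] smooth_frechet_plane[OF sm(4), of p a b] fs ft c_def s_def)
  show 3: "inner (?d1 (1, 0)) (e3 p) = sin (\<phi> p / 2)"
    using II'[of 1 0] nz(1) by (simp add: anti flip: s_def)
  show 6: "inner (?d2 (0, 1)) (e3 p) = - cos (\<phi> p / 2)"
  proof -
    have "- (s * inner (?d2 (0, 1)) (e3 p)) = c * s"
      using II'[of 0 1] by (simp add: anti)
    then have "s * (inner (?d2 (0, 1)) (e3 p) + c) = 0" by algebra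
    then show ?thesis using nz(2) by (simp add: c_def)
  qed
  have sum0: "c * inner (?d1 (0, 1)) (e3 p) + s * inner (?d2 (1, 0)) (e3 p) = 0"
    using II'[of 1 1] 3 6 by (simp add: inner_add_left inner_add_right anti flip: c_def s_def)
  have fst: "((\<lambda>p. cos (\<phi> p / 2) *\<^sub>R e1 p) has_derivative
      (\<lambda>v. c *\<^sub>R ?d1 v + (- s * (frechet_derivative \<phi> (at p) v / 2)) *\<^sub>R e1 p)) (at p)"
    unfolding c_def s_def by (auto intro!: derivative_eq_intros \<phi>' D simp: fun_eq_iff)
  have fts: "((\<lambda>p. sin (\<phi> p / 2) *\<^sub>R e2 p) has_derivative
      (\<lambda>v. s *\<^sub>R ?d2 v + (c * (frechet_derivative \<phi> (at p) v / 2)) *\<^sub>R e2 p)) (at p)"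
    unfolding c_def s_def by (auto intro!: derivative_eq_intros \<phi>' D simp: fun_eq_iff)
  have mixed: "c *\<^sub>R ?d1 (0, 1) + (- s * (frechet_derivative \<phi> (at p) (0, 1) / 2)) *\<^sub>R e1 p
      = s *\<^sub>R ?d2 (1, 0) + (c * (frechet_derivative \<phi> (at p) (1, 0) / 2)) *\<^sub>R e2 p"
    using smooth_mixed_partials[OF sm(1), of p]
    unfolding fs ft frechet_derivative_at[OF fst, symmetric] frechet_derivative_at[OF fts, symmetric] .
  have "c * inner (?d1 (0, 1)) (e3 p) = s * inner (?d2 (1, 0)) (e3 p)"
    using arg_cong[OF mixed, of "\<lambda>x. inner x (e3 p)"] by (simp add: inner_add_left inner_diff_left on1)
  with sum0 nz show "inner (?d1 (0, 1)) (e3 p) = 0" "inner (?d2 (1, 0)) (e3 p) = 0" by auto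
  show "inner (?d1 (1, 0)) (e2 p) = frechet_derivative \<phi> (at p) (0, 1) / 2"
    using arg_cong[OF mixed, of "\<lambda>x. inner x (e1 p)"] nz by (simp add: inner_add_left inner_diff_left on1 anti)
  show "inner (?d1 (0, 1)) (e2 p) = frechet_derivative \<phi> (at p) (1, 0) / 2"
    using arg_cong[OF mixed, of "\<lambda>x. inner x (e2 p)"] nz by (simp add: inner_add_left inner_diff_left on1 anti)
qed

lemma continuous_eq_on_dense:
  fixes f g :: "'a::topological_space \<Rightarrow> real"
  assumes "continuous_on UNIV f" "continuous_on UNIV g" "closure S = UNIV" "\<And>x. x \<in> S \<Longrightarrow> f x = g x"
  shows "f x = g x"
proof -
  have "closure S \<subseteq> {x. f x = g x}"
    using assms by (intro closure_minimal closed_Collect_eq) auto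
  with assms(3) show ?thesis by auto
qed

text \<open>The forms degenerate where \<open>\<phi> \<in> \<pi>\<int>\<close>, and there the coefficients are pinned down by continuity
only.\<close>

lemma structure_equations:
  assumes frame: "pseudospherical_frame \<phi> f e1 e2 e3" and \<phi>: "smooth \<phi>"
    and dense: "closure {p. \<forall>k::int. \<phi> p \<noteq> of_int k * pi} = UNIV"
  shows "inner (frechet_derivative e1 (at p) (1, 0)) (e2 p) = frechet_derivative \<phi> (at p) (0, 1) / 2"
    and "inner (frechet_derivative e1 (at p) (0, 1)) (e2 p) = frechet_derivative \<phi> (at p) (1, 0) / 2"
    and "inner (frechet_derivative e1 (at p) (1, 0)) (e3 p) = sin (\<phi> p / 2)"
    and "inner (frechet_derivative e1 (at p) (0, 1)) (e3 p) = 0"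
    and "inner (frechet_derivative e2 (at p) (1, 0)) (e3 p) = 0"
    and "inner (frechet_derivative e2 (at p) (0, 1)) (e3 p) = - cos (\<phi> p / 2)"
proof -
  have sm: "smooth e1" "smooth e2" "smooth e3"
    using frame unfolding pseudospherical_frame_def by auto
  note [continuous_intros] = smooth_continuous_on[OF \<phi>] smooth_continuous_on[OF smooth_directional_derivative[OF \<phi>]]
    smooth_continuous_on[OF sm(1)] smooth_continuous_on[OF sm(2)] smooth_continuous_on[OF sm(3)]
    smooth_continuous_on[OF smooth_directional_derivative[OF sm(1)]]
    smooth_continuous_on[OF smooth_directional_derivative[OF sm(2)]]
  note reg = structure_equations_at_regular_point[OF frame \<phi>]
  show "inner (frechet_derivative e1 (at p) (1, 0)) (e2 p) = frechet_derivative \<phi> (at p) (0, 1) / 2"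
    by (rule continuous_eq_on_dense[OF _ _ dense, of _ _ p]) (auto intro!: continuous_intros simp: reg(1))
  show "inner (frechet_derivative e1 (at p) (0, 1)) (e2 p) = frechet_derivative \<phi> (at p) (1, 0) / 2"
    by (rule continuous_eq_on_dense[OF _ _ dense, of _ _ p]) (auto intro!: continuous_intros simp: reg(2))
  show "inner (frechet_derivative e1 (at p) (1, 0)) (e3 p) = sin (\<phi> p / 2)"
    by (rule continuous_eq_on_dense[OF _ _ dense, of _ _ p]) (auto intro!: continuous_intros simp: reg(3))
  show "inner (frechet_derivative e1 (at p) (0, 1)) (e3 p) = 0"
    by (rule continuous_eq_on_dense[OF _ _ dense, of _ _ p]) (auto intro!: continuous_intros simp: reg(4))
  show "inner (frechet_derivative e2 (at p) (1, 0)) (e3 p) = 0"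
    by (rule continuous_eq_on_dense[OF _ _ dense, of _ _ p]) (auto intro!: continuous_intros simp: reg(5))
  show "inner (frechet_derivative e2 (at p) (0, 1)) (e3 p) = - cos (\<phi> p / 2)"
    by (rule continuous_eq_on_dense[OF _ _ dense, of _ _ p]) (auto intro!: continuous_intros simp: reg(6))
qed

text \<open>The structure equations depend only on \<open>\<phi>\<close>, so the adapted frames differ by a constant rotation
\<open>A\<close>; then \<open>g - A f\<close> has derivative zero.\<close>

theorem pseudospherical_map_unique:
  assumes f: "is_pseudospherical_map \<phi> f" and g: "is_pseudospherical_map \<phi> g" and \<phi>: "smooth \<phi>"
    and dense: "closure {p. \<forall>k::int. \<phi> p \<noteq> of_int k * pi} = UNIV"
  obtains A b where "rotation_matrix A" "\<And>p. g p = A *v f p + b"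
proof -
  obtain e1 e2 e3 where e: "pseudospherical_frame \<phi> f e1 e2 e3"
    using f unfolding is_pseudospherical_map_iff_frame by blast
  obtain d1 d2 d3 where d: "pseudospherical_frame \<phi> g d1 d2 d3"
    using g unfolding is_pseudospherical_map_iff_frame by blast
  have sme: "smooth f" "smooth e1" "smooth e2" "smooth e3" "\<And>p. oriented_orthonormal (e1 p) (e2 p) (e3 p)"
    "\<And>p. frechet_derivative f (at p) (1, 0) = cos (\<phi> p / 2) *\<^sub>R e1 p"
    "\<And>p. frechet_derivative f (at p) (0, 1) = sin (\<phi> p / 2) *\<^sub>R e2 p"
    using e unfolding pseudospherical_frame_def by auto
  have smd: "smooth g" "smooth d1" "smooth d2" "smooth d3" "\<And>p. oriented_orthonormal (d1 p) (d2 p) (d3 p)"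
    "\<And>p. frechet_derivative g (at p) (1, 0) = cos (\<phi> p / 2) *\<^sub>R d1 p"
    "\<And>p. frechet_derivative g (at p) (0, 1) = sin (\<phi> p / 2) *\<^sub>R d2 p"
    using d unfolding pseudospherical_frame_def by auto
  note se = structure_equations[OF e \<phi> dense] and sd = structure_equations[OF d \<phi> dense]
  have plane: "frechet_derivative h (at p) v =
      fst v *\<^sub>R frechet_derivative h (at p) (1, 0) + snd v *\<^sub>R frechet_derivative h (at p) (0, 1)"
    if "smooth h" for h :: "real \<times> real \<Rightarrow> real ^ 3" and p v
    using smooth_frechet_plane[OF that, of p "fst v" "snd v"] by simp
  obtain A where A: "rotation_matrix A"
    "\<And>p. d1 p = A *v e1 p" "\<And>p. d2 p = A *v e2 p" "\<And>p. d3 p = A *v e3 p"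
  proof (rule frames_congruent[OF sme(5) smd(5) smooth_has_derivative[OF sme(2)] smooth_has_derivative[OF sme(3)]
        smooth_has_derivative[OF sme(4)] smooth_has_derivative[OF smd(2)] smooth_has_derivative[OF smd(3)]
        smooth_has_derivative[OF smd(4)]])
    fix p v
    show "inner (frechet_derivative e1 (at p) v) (e2 p) = inner (frechet_derivative d1 (at p) v) (d2 p)"
      unfolding plane[OF sme(2), of p v] plane[OF smd(2), of p v]
      by (simp only: inner_add_left inner_scaleR_left se sd)
    show "inner (frechet_derivative e1 (at p) v) (e3 p) = inner (frechet_derivative d1 (at p) v) (d3 p)"
      unfolding plane[OF sme(2), of p v] plane[OF smd(2), of p v]
      by (simp only: inner_add_left inner_scaleR_left se sd)
    show "inner (frechet_derivative e2 (at p) v) (e3 p) = inner (frechet_derivative d2 (at p) v) (d3 p)"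
      unfolding plane[OF sme(3), of p v] plane[OF smd(3), of p v]
      by (simp only: inner_add_left inner_scaleR_left se sd)
  qed (rule that, simp_all)
  have "((\<lambda>p. g p - A *v f p) has_derivative (\<lambda>v. 0)) (at p)" for p
  proof -
    have "((\<lambda>p. g p - A *v f p) has_derivative
        (\<lambda>v. frechet_derivative g (at p) v - A *v frechet_derivative f (at p) v)) (at p)"
      by (intro has_derivative_diff smooth_has_derivative[OF smd(1)]
          bounded_linear.has_derivative[OF matrix_vector_mul_bounded_linear] smooth_has_derivative[OF sme(1)])
    moreover have "frechet_derivative g (at p) v - A *v frechet_derivative f (at p) v = 0" for v
      unfolding plane[OF sme(1), of p v] plane[OF smd(1), of p v]
      by (simp add: sme smd A matrix_vector_right_distrib matrix_vector_mult_scaleR)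
    ultimately show ?thesis by simp
  qed
  then obtain b where "\<And>p. g p - A *v f p = b"
    using has_derivative_zero_constant[of UNIV "\<lambda>p. g p - A *v f p"] by auto
  then have "g p = A *v f p + b" for p by (metis add.commute diff_add_cancel)
  with A(1) show ?thesis by (rule that)
qed

section \<open>Helicoidal maps and the profile curve\<close>

text \<open>The vector with coordinates \<open>(a, b, c)\<close> in the standard frame turned by the angle \<open>\<theta>\<close> about the
third axis. Computing in this moving frame removes the angle from all inner products and reduces
derivatives to derivatives of coordinates plus the term from turning the frame.\<close>

definition cylindrical :: "real \<Rightarrow> real \<Rightarrow> real \<Rightarrow> real \<Rightarrow> real ^ 3" where
  "cylindrical \<theta> a b c = vector [a * cos \<theta> - b * sin \<theta>, a * sin \<theta> + b * cos \<theta>, c]"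

lemma inner_cylindrical:
  "inner (cylindrical \<theta> a b c) (cylindrical \<theta> a' b' c') = a * a' + b * b' + c * c'"
proof -
  have "cos \<theta> * cos \<theta> + sin \<theta> * sin \<theta> = 1" by (simp flip: power2_eq_square)
  then show ?thesis
    unfolding cylindrical_def inner_vec_def sum_3 vector_3 inner_real_def by algebra
qed

lemma scaleR_cylindrical: "x *\<^sub>R cylindrical \<theta> a b c = cylindrical \<theta> (x * a) (x * b) (x * c)"
  by (simp add: cylindrical_def vec_eq_iff forall_3 algebra_simps)

lemma det_cylindrical:
  "det (vector [cylindrical \<theta> a1 b1 c1, cylindrical \<theta> a2 b2 c2, cylindrical \<theta> a3 b3 c3] :: real ^ 3 ^ 3)
     = a1 * (b2 * c3 - b3 * c2) - b1 * (a2 * c3 - a3 * c2) + c1 * (a2 * b3 - a3 * b2)"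
proof -
  have "cos \<theta> * cos \<theta> + sin \<theta> * sin \<theta> = 1" by (simp flip: power2_eq_square)
  then show ?thesis
    unfolding det_3 cylindrical_def vector_3 by algebra
qed

lemma cylindrical_cong:
  "a = a' \<Longrightarrow> b = b' \<Longrightarrow> c = c' \<Longrightarrow> cylindrical \<theta> a b c = cylindrical \<theta> a' b' c'"
  by simp

lemma oriented_orthonormal_cylindrical:
  assumes "a1 * a1 + b1 * b1 + c1 * c1 = 1" "a2 * a2 + b2 * b2 + c2 * c2 = 1" "a3 * a3 + b3 * b3 + c3 * c3 = 1"
    "a1 * a2 + b1 * b2 + c1 * c2 = 0" "a1 * a3 + b1 * b3 + c1 * c3 = 0" "a2 * a3 + b2 * b3 + c2 * c3 = 0"
    "a1 * (b2 * c3 - b3 * c2) - b1 * (a2 * c3 - a3 * c2) + c1 * (a2 * b3 - a3 * b2) = 1"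
  shows "oriented_orthonormal (cylindrical \<theta> a1 b1 c1) (cylindrical \<theta> a2 b2 c2) (cylindrical \<theta> a3 b3 c3)"
  unfolding oriented_orthonormal_def by (simp add: norm_eq_1 inner_cylindrical det_cylindrical assms)

lemma has_derivative_cylindrical:
  assumes "(\<theta> has_derivative \<theta>') (at p)" "(a has_derivative a') (at p)"
    "(b has_derivative b') (at p)" "(c has_derivative c') (at p)"
  shows "((\<lambda>p. cylindrical (\<theta> p) (a p) (b p) (c p)) has_derivative
     (\<lambda>v. cylindrical (\<theta> p) (a' v - b p * \<theta>' v) (b' v + a p * \<theta>' v) (c' v))) (at p)"
  unfolding cylindrical_def
  by (rule has_derivative_eq_rhs, rule has_derivative_vector3)
    (auto intro!: derivative_eq_intros assms simp: fun_eq_iff algebra_simps)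

text \<open>Below, \<open>\<alpha>\<close>, \<open>S\<close>, \<open>C\<close>, \<open>D\<close> are the amplitude, sine, cosine and delta amplitude with the reciprocal
parameter \<open>1 / m\<close> at the argument \<open>\<surd>m u\<close>, so that \<open>sn (u, m) = S / \<surd>m\<close>, \<open>cn (u, m) = D\<close> and
\<open>dn (u, m) = C\<close>. The polynomial relations between these functions are recorded with products
written out, in the form in which Groebner basis computations use them.\<close>

locale helicoid_parameters =
  fixes m r :: real
  assumes m: "1 < m" and r: "0 < r"
begin

definition \<alpha> :: "real \<Rightarrow> real" where "\<alpha> u = jacobi_am (sqrt m * u) (1 / m)"
definition S :: "real \<Rightarrow> real" where "S u = sin (\<alpha> u)"
definition C :: "real \<Rightarrow> real" where "C u = cos (\<alpha> u)"
definition D :: "real \<Rightarrow> real" where "D u = sqrt (1 - 1 / m * (S u)\<^sup>2)"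
definition N :: "real \<Rightarrow> real" where "N u = (S u)\<^sup>2 + (sinh r)\<^sup>2"
definition \<nu> :: "real \<Rightarrow> real" where "\<nu> u = 1 / sqrt (N u)"
definition \<kappa> :: real where "\<kappa> = sqrt (m + (sinh r)\<^sup>2)"

lemma sinh_pos: "sinh r > 0" using r by simp

lemma modulus: "0 \<le> 1 / m" "1 / m < 1" using m by auto

lemma N_pos: "N u > 0"
  using sinh_pos by (simp add: N_def add_nonneg_pos)

lemma kappa_pos: "\<kappa> > 0" unfolding \<kappa>_def using m by (simp add: add_pos_nonneg)

lemma radicand_pos: "0 < 1 - 1 / m * (S u)\<^sup>2"
  unfolding S_def by (rule one_minus_mult_sin_sq_pos[OF modulus(2)])

lemma D_pos: "D u > 0" using radicand_pos by (simp add: D_def)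

lemma rel_SC: "S u * S u + C u * C u = 1"
  by (simp add: S_def C_def flip: power2_eq_square)

lemma rel_D: "m * (D u * D u) = m - S u * S u"
  using radicand_pos[of u] m by (simp add: D_def field_simps power2_eq_square)

lemma rel_nu: "\<nu> u * \<nu> u * (S u * S u + sinh r * sinh r) = 1"
proof -
  have "\<nu> u * \<nu> u * N u = 1" using N_pos[of u] by (simp add: \<nu>_def)
  then show ?thesis by (simp add: N_def power2_eq_square)
qed

lemma rel_cosh: "cosh r * cosh r = 1 + sinh r * sinh r"
  using cosh_square_eq[of r] by (simp add: power2_eq_square)

lemma rel_kappa: "\<kappa> * \<kappa> = m + sinh r * sinh r"
  using m by (simp add: \<kappa>_def power2_eq_square)

lemma rel_sqrt: "sqrt m * sqrt m = m" using m by simp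

lemma alpha_deriv: "(\<alpha> has_real_derivative sqrt m * D u) (at u)"
  unfolding \<alpha>_def[abs_def] D_def S_def
  by (rule DERIV_cong[OF DERIV_chain2[OF DERIV_jacobi_am[OF modulus]]])
    (auto intro!: derivative_eq_intros)

lemma S_deriv: "(S has_real_derivative sqrt m * C u * D u) (at u)"
  unfolding S_def[abs_def] C_def by (auto intro!: derivative_eq_intros alpha_deriv)

lemma C_deriv: "(C has_real_derivative - sqrt m * S u * D u) (at u)"
  unfolding C_def[abs_def] S_def by (auto intro!: derivative_eq_intros alpha_deriv)

lemma D_deriv: "(D has_real_derivative - (S u * C u / sqrt m)) (at u)"
proof -
  have "((\<lambda>u. sqrt (1 - 1 / m * (S u)\<^sup>2)) has_real_derivative
      inverse (sqrt (1 - 1 / m * (S u)\<^sup>2)) / 2 * (0 - 1 / m * (2 * S u * (sqrt m * C u * D u)))) (at u)"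
    by (rule DERIV_chain2[where f = sqrt and g = "\<lambda>u. 1 - 1 / m * (S u)\<^sup>2" and x = u, OF DERIV_real_sqrt[OF radicand_pos]])
      (use m in \<open>auto intro!: derivative_eq_intros S_deriv\<close>)
  moreover have "inverse (sqrt (1 - 1 / m * (S u)\<^sup>2)) / 2 * (0 - 1 / m * (2 * S u * (sqrt m * C u * D u)))
      = - (S u * C u / sqrt m)"
    unfolding D_def[symmetric] using D_pos[of u] m rel_sqrt by (simp add: field_simps)
  ultimately show ?thesis by (simp add: D_def[abs_def])
qed

lemma nu_deriv: "(\<nu> has_real_derivative - (\<nu> u * \<nu> u * \<nu> u * (sqrt m * S u * C u * D u))) (at u)"
proof -
  have sq: "((\<lambda>u. sqrt (N u)) has_real_derivative inverse (sqrt (N u)) / 2 * (2 * S u * (sqrt m * C u * D u))) (at u)"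
    by (rule DERIV_chain2[where f = sqrt and g = N and x = u, OF DERIV_real_sqrt[OF N_pos]])
      (auto simp: N_def[abs_def] intro!: derivative_eq_intros S_deriv)
  have "((\<lambda>u. inverse (sqrt (N u))) has_real_derivative
      - (inverse (sqrt (N u)) / 2 * (2 * S u * (sqrt m * C u * D u)) * inverse ((sqrt (N u))\<^sup>2))) (at u)"
    using DERIV_inverse_fun[OF sq] N_pos[of u] by (simp add: power2_eq_square)
  moreover have "- (inverse (sqrt (N u)) / 2 * (2 * S u * (sqrt m * C u * D u)) * inverse ((sqrt (N u))\<^sup>2))
      = - (\<nu> u * \<nu> u * \<nu> u * (sqrt m * S u * C u * D u))"
    unfolding \<nu>_def power2_eq_square inverse_mult_distrib inverse_eq_divide[symmetric] by algebra
  ultimately have "((\<lambda>u. inverse (sqrt (N u))) has_real_derivative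
      - (\<nu> u * \<nu> u * \<nu> u * (sqrt m * S u * C u * D u))) (at u)"
    by (rule DERIV_cong)
  moreover have "(\<lambda>u. inverse (sqrt (N u))) = \<nu>"
    by (simp add: fun_eq_iff \<nu>_def inverse_eq_divide)
  ultimately show ?thesis by metis
qed

text \<open>The factor \<open>D\<close> in the derivative of the amplitude cancels the square root in the integrand of
\<open>\<Pi>\<close>.\<close>

lemma helicoid_psi_deriv:
  "(helicoid_psi m r has_real_derivative - (\<kappa> * cosh r * sinh r * \<nu> u * \<nu> u)) (at u)"
proof -
  define f where "f x = 1 / ((1 - (- (1 / sinh r)\<^sup>2) * (sin x)\<^sup>2) * sqrt (1 - 1 / m * (sin x)\<^sup>2))" for x :: real
  have p1: "1 - (- (1 / sinh r)\<^sup>2) * (sin x)\<^sup>2 > 0" for x :: real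
    by (simp add: add_pos_nonneg)
  have p2: "sqrt (1 - 1 / m * (sin x)\<^sup>2) > 0" for x
    using one_minus_mult_sin_sq_pos[OF modulus(2)] by simp
  have "continuous_on UNIV f"
    unfolding f_def by (intro continuous_intros) (use p1 p2 in \<open>metis less_irrefl mult_eq_0_iff\<close>)
  then have "((\<lambda>\<phi>. ellint_Pi (- (1 / sinh r)\<^sup>2) \<phi> (1 / m)) has_real_derivative f x) (at x)" for x
    unfolding ellint_Pi_def f_def by (rule interval_integral_has_real_derivative)
  then have "((\<lambda>u. ellint_Pi (- (1 / sinh r)\<^sup>2) (\<alpha> u) (1 / m)) has_real_derivative f (\<alpha> u) * (sqrt m * D u)) (at u)"
    by (rule DERIV_chain2[OF _ alpha_deriv])
  then have "(helicoid_psi m r has_real_derivative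
      - (\<kappa> * (cosh r / sinh r) / sqrt m) * (f (\<alpha> u) * (sqrt m * D u))) (at u)"
    unfolding helicoid_psi_def[abs_def] \<alpha>_def[symmetric] \<kappa>_def[symmetric] by (rule DERIV_cmult)
  moreover have "- (\<kappa> * (cosh r / sinh r) / sqrt m) * (f (\<alpha> u) * (sqrt m * D u))
      = - (\<kappa> * cosh r * sinh r * \<nu> u * \<nu> u)"
  proof -
    have f: "f (\<alpha> u) = 1 / ((1 + (S u / sinh r)\<^sup>2) * D u)"
      by (simp add: f_def S_def D_def power_divide)
    have "1 + (S u / sinh r)\<^sup>2 = N u / (sinh r)\<^sup>2"
      using sinh_pos by (simp add: N_def field_simps power2_eq_square)
    moreover have "\<nu> u * \<nu> u = 1 / N u" using N_pos[of u] by (simp add: \<nu>_def)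
    ultimately show ?thesis
      unfolding f mult.assoc[of _ "\<nu> u"] using N_pos[of u] D_pos[of u] sinh_pos m
      by (simp add: field_simps power2_eq_square)
  qed
  ultimately show ?thesis by simp
qed

text \<open>The derivative of the term with \<open>E\<close> is \<open>m D\<^sup>2 = m - S\<^sup>2\<close>, which turns the constant
\<open>cosh\<^sup>2 r + m - 1\<close> into \<open>sinh\<^sup>2 r + S\<^sup>2\<close>.\<close>

lemma helicoid_zeta_deriv:
  "(helicoid_zeta m r has_real_derivative inverse \<kappa> * (S u * S u + sinh r * sinh r)) (at u)"
proof -
  have "continuous_on UNIV (\<lambda>x. sqrt (1 - 1 / m * (sin x)\<^sup>2))" by (intro continuous_intros)
  then have "((\<lambda>\<phi>. ellint_E \<phi> (1 / m)) has_real_derivative sqrt (1 - 1 / m * (sin x)\<^sup>2)) (at x)" for x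
    unfolding ellint_E_def by (rule interval_integral_has_real_derivative)
  then have "((\<lambda>u. ellint_E (\<alpha> u) (1 / m)) has_real_derivative D u * (sqrt m * D u)) (at u)"
    unfolding D_def S_def by (rule DERIV_chain2[OF _ alpha_deriv[unfolded D_def S_def]])
  then have "(helicoid_zeta m r has_real_derivative
      (((cosh r)\<^sup>2 + m - 1) - sqrt m * (D u * (sqrt m * D u))) / \<kappa>) (at u)"
    unfolding helicoid_zeta_def[abs_def] \<alpha>_def[symmetric] \<kappa>_def[symmetric]
    using kappa_pos by (auto intro!: derivative_eq_intros)
  moreover have "((cosh r)\<^sup>2 + m - 1) - sqrt m * (D u * (sqrt m * D u)) = S u * S u + sinh r * sinh r"
    using rel_D[of u] rel_sqrt rel_cosh by algebra
  ultimately show ?thesis by (simp add: divide_inverse mult.commute)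
qed

text \<open>The horizontal coordinates \<open>\<xi> q\<^sup>1\<close> and \<open>\<xi> q\<^sup>2\<close> of the profile curve before it is turned by \<open>\<psi>\<close>,
expressed through \<open>S, C, D, \<nu>\<close> without radicals.\<close>

definition P1 :: "real \<Rightarrow> real" where
  "P1 u = sqrt m * cosh r * sinh r * (inverse \<kappa> * inverse \<kappa>) * (D u * \<nu> u)"
definition P2 :: "real \<Rightarrow> real" where
  "P2 u = inverse \<kappa> * (C u * S u * \<nu> u)"

lemma helicoid_xi_eq: "helicoid_xi m r u = sqrt m * \<nu> u"
proof -
  have "m * (S u / sqrt m)\<^sup>2 = (S u)\<^sup>2" using m by (simp add: power_divide)
  then show ?thesis
    unfolding helicoid_xi_def jacobi_sn_reciprocal[OF m] \<alpha>_def[symmetric] S_def[symmetric]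
    by (simp add: \<nu>_def N_def real_sqrt_divide)
qed

lemma helicoid_q1_eq: "helicoid_q1 m r u = cosh r * sinh r / (\<kappa> * \<kappa>) * D u"
  unfolding helicoid_q1_def jacobi_cn_reciprocal[OF m] \<alpha>_def[symmetric] S_def[symmetric] D_def rel_kappa
  by (simp add: power2_eq_square)

lemma helicoid_q2_eq: "helicoid_q2 m r u = C u * S u / (sqrt m * \<kappa>)"
  unfolding helicoid_q2_def jacobi_sn_reciprocal[OF m] jacobi_dn_reciprocal[OF m] \<alpha>_def[symmetric] S_def C_def \<kappa>_def
  by simp

lemma helicoid_x_eq: "helicoid_x m r u = P1 u * cos (helicoid_psi m r u) - P2 u * sin (helicoid_psi m r u)"
  unfolding helicoid_x_def helicoid_xi_eq helicoid_q1_eq helicoid_q2_eq P1_def P2_def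
  using m by (simp add: divide_inverse algebra_simps)

lemma helicoid_y_eq: "helicoid_y m r u = P1 u * sin (helicoid_psi m r u) + P2 u * cos (helicoid_psi m r u)"
  unfolding helicoid_y_def helicoid_xi_eq helicoid_q1_eq helicoid_q2_eq P1_def P2_def
  using m by (simp add: divide_inverse algebra_simps)

text \<open>The substitution \<open>2 \<pi> v = \<kappa> w\<close> makes the derivative along \<open>w\<close> as long as the vector
\<open>(cosh r, - sinh r)\<close> in the first fundamental form, which is the direction along which \<open>u\<close> is
constant and \<open>w\<close> has unit speed.\<close>

lemma helicoid_param_eq:
  "helicoid_param m r (u, \<kappa> * w / (2 * pi)) =
     cylindrical (\<kappa> * w + helicoid_psi m r u) (P1 u) (P2 u) (helicoid_zeta m r u - cosh r * sinh r / \<kappa> * w)"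
proof -
  have v: "2 * pi * (\<kappa> * w / (2 * pi)) = \<kappa> * w" by simp
  have "helicoid_rho m r * (\<kappa> * w / (2 * pi)) = - (cosh r * sinh r / (\<kappa> * \<kappa>) * (\<kappa> * w))"
    unfolding helicoid_rho_def rel_kappa by (simp add: power2_eq_square)
  also have "\<dots> = - (cosh r * sinh r / \<kappa> * w)" using kappa_pos by simp
  finally have z: "helicoid_rho m r * (\<kappa> * w / (2 * pi)) = - (cosh r * sinh r / \<kappa> * w)" .
  show ?thesis
    unfolding helicoid_param_def prod.case v z helicoid_x_eq helicoid_y_eq cylindrical_def cos_add sin_add
    by (simp add: algebra_simps)
qed

lemma rel_inverse: "\<kappa> * inverse \<kappa> = 1" "sqrt m * inverse (sqrt m) = 1"
  using kappa_pos m by auto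

lemma P1_deriv: "(P1 has_real_derivative - (cosh r * sinh r * S u * C u * (\<nu> u * \<nu> u * \<nu> u))) (at u)"
proof -
  have "(P1 has_real_derivative sqrt m * cosh r * sinh r * (inverse \<kappa> * inverse \<kappa>) *
      (- (S u * C u / sqrt m) * \<nu> u + (- (\<nu> u * \<nu> u * \<nu> u * (sqrt m * S u * C u * D u))) * D u)) (at u)"
    unfolding P1_def[abs_def] by (intro DERIV_cmult DERIV_mult D_deriv nu_deriv)
  moreover have "sqrt m * cosh r * sinh r * (inverse \<kappa> * inverse \<kappa>) *
      (- (S u * C u / sqrt m) * \<nu> u + (- (\<nu> u * \<nu> u * \<nu> u * (sqrt m * S u * C u * D u))) * D u)
      = - (cosh r * sinh r * S u * C u * (\<nu> u * \<nu> u * \<nu> u))"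
    using rel_D[of u] rel_sqrt rel_kappa rel_nu[of u] rel_inverse unfolding divide_inverse by algebra
  ultimately show ?thesis by (rule DERIV_cong)
qed

lemma P2_deriv: "(P2 has_real_derivative inverse \<kappa> * sqrt m * D u * (\<nu> u * \<nu> u * \<nu> u) *
    ((S u * S u + sinh r * sinh r) * (C u * C u - S u * S u) - S u * S u * (C u * C u))) (at u)"
proof -
  have "(P2 has_real_derivative inverse \<kappa> *
      (((- sqrt m * S u * D u) * S u + (sqrt m * C u * D u) * C u) * \<nu> u
        + (- (\<nu> u * \<nu> u * \<nu> u * (sqrt m * S u * C u * D u))) * (C u * S u))) (at u)"
    unfolding P2_def[abs_def] by (intro DERIV_cmult DERIV_mult C_deriv S_deriv nu_deriv)
  moreover have "inverse \<kappa> *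
      (((- sqrt m * S u * D u) * S u + (sqrt m * C u * D u) * C u) * \<nu> u
        + (- (\<nu> u * \<nu> u * \<nu> u * (sqrt m * S u * C u * D u))) * (C u * S u))
      = inverse \<kappa> * sqrt m * D u * (\<nu> u * \<nu> u * \<nu> u) *
    ((S u * S u + sinh r * sinh r) * (C u * C u - S u * S u) - S u * S u * (C u * C u))"
    using rel_nu[of u] by algebra
  ultimately show ?thesis by (rule DERIV_cong)
qed

text \<open>Orthogonal coordinates for the Lorentz metric \<open>ds\<^sup>2 - dt\<^sup>2\<close>: \<open>dW\<^sup>2 - dU\<^sup>2 = ds\<^sup>2 - dt\<^sup>2\<close>. The angle
function depends on \<open>U\<close> only.\<close>

definition U :: "real \<times> real \<Rightarrow> real" where "U p = sinh r * fst p + cosh r * snd p"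
definition W :: "real \<times> real \<Rightarrow> real" where "W p = cosh r * fst p + sinh r * snd p"
definition \<Theta> :: "real \<times> real \<Rightarrow> real" where "\<Theta> p = \<kappa> * W p + helicoid_psi m r (U p)"

lemma U_deriv: "(U has_derivative U) (at p)"
  unfolding U_def[abs_def] by (auto intro!: derivative_eq_intros)

lemma W_deriv: "(W has_derivative W) (at p)"
  unfolding W_def[abs_def] by (auto intro!: derivative_eq_intros)

lemma compose_U_deriv:
  assumes "(g has_real_derivative g') (at (U p))"
  shows "((\<lambda>p. g (U p)) has_derivative (\<lambda>v. g' * U v)) (at p)"
  using has_derivative_compose[OF U_deriv assms[unfolded has_field_derivative_def]] .

lemma Theta_deriv:
  "(\<Theta> has_derivative (\<lambda>v. \<kappa> * W v - \<kappa> * cosh r * sinh r * \<nu> (U p) * \<nu> (U p) * U v)) (at p)"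
proof -
  have "(\<Theta> has_derivative (\<lambda>v. \<kappa> * W v + (- (\<kappa> * cosh r * sinh r * \<nu> (U p) * \<nu> (U p))) * U v)) (at p)"
    unfolding \<Theta>_def[abs_def]
    by (intro has_derivative_add has_derivative_mult_right W_deriv compose_U_deriv helicoid_psi_deriv)
  then show ?thesis by simp
qed

text \<open>The negative of the parametrization in the coordinates \<open>(U, W)\<close>. The sign reverses the orientation,
which is what gives the second fundamental form the required sign.\<close>

definition helicoid_map :: "real \<times> real \<Rightarrow> real ^ 3" where
  "helicoid_map p = cylindrical (\<Theta> p) (- P1 (U p)) (- P2 (U p))
     (inverse \<kappa> * (cosh r * sinh r) * W p - helicoid_zeta m r (U p))"

text \<open>The adapted frame: \<open>frame1 = (sinh r C T + cosh r S R) / n\<close>,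
\<open>frame2 = (cosh r S T - sinh r C R) / n\<close> and their cross product \<open>frame3\<close>, with \<open>R\<close>, \<open>T\<close>, \<open>n\<close> as
in the introduction.\<close>

definition frame1 :: "real \<times> real \<Rightarrow> real ^ 3" where
  "frame1 p = cylindrical (\<Theta> p) (cosh r * (S (U p) * \<nu> (U p)))
     (- (sqrt m * inverse \<kappa> * sinh r) * (D (U p) * C (U p) * \<nu> (U p)))
     (inverse \<kappa> * sinh r * C (U p))"

definition frame2 :: "real \<times> real \<Rightarrow> real ^ 3" where
  "frame2 p = cylindrical (\<Theta> p) (- sinh r * (C (U p) * \<nu> (U p)))
     (- (sqrt m * inverse \<kappa> * cosh r) * (D (U p) * S (U p) * \<nu> (U p)))
     (inverse \<kappa> * cosh r * S (U p))"

definition frame3 :: "real \<times> real \<Rightarrow> real ^ 3" where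
  "frame3 p = cylindrical (\<Theta> p) 0
     (- inverse \<kappa> * ((S (U p) * S (U p) + sinh r * sinh r) * \<nu> (U p)))
     (- (sqrt m * inverse \<kappa>) * D (U p))"

lemma helicoid_map_eq: "helicoid_map p = - helicoid_param m r (U p, \<kappa> * W p / (2 * pi))"
  unfolding helicoid_param_eq helicoid_map_def \<Theta>_def
  using scaleR_cylindrical[of "- 1" "\<kappa> * W p + helicoid_psi m r (U p)"] by (simp add: divide_inverse algebra_simps)

lemma range_helicoid_map: "range helicoid_map = uminus ` range (helicoid_param m r)"
proof -
  have "\<exists>p. x = (U p, \<kappa> * W p / (2 * pi))" for x
  proof -
    obtain u v where x: "x = (u, v)" by (cases x)
    define w where "w = 2 * pi * v / \<kappa>"
    let ?p = "(cosh r * w - sinh r * u, cosh r * u - sinh r * w)"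
    have "U ?p = u" "W ?p = w"
      unfolding U_def W_def fst_conv snd_conv using rel_cosh by algebra+
    then show ?thesis using kappa_pos by (intro exI[of _ ?p]) (simp add: x w_def)
  qed
  then have surj: "range (\<lambda>p. (U p, \<kappa> * W p / (2 * pi))) = UNIV"
    unfolding surj_def by blast
  have "range helicoid_map = uminus ` helicoid_param m r ` range (\<lambda>p. (U p, \<kappa> * W p / (2 * pi)))"
    unfolding helicoid_map_eq[abs_def] image_image ..
  then show ?thesis unfolding surj .
qed

text \<open>In the moving frame the radial component along \<open>U\<close> cancels between the derivative of \<open>P1\<close> and the
rotation by \<open>\<psi>\<close>; this cancellation is the reason for the choice of \<open>\<psi>\<close>. The remaining component
simplifies through
\<open>N (C\<^sup>2 - S\<^sup>2) - S\<^sup>2 C\<^sup>2 - cosh\<^sup>2 r sinh\<^sup>2 r = - N\<^sup>2\<close> with \<open>N = S\<^sup>2 + sinh\<^sup>2 r\<close>.\<close>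

lemma helicoid_map_deriv:
  "(helicoid_map has_derivative (\<lambda>v. cylindrical (\<Theta> p) (S (U p) * C (U p) * \<nu> (U p) * W v)
     (sqrt m * inverse \<kappa> * D (U p) * \<nu> (U p) *
        ((S (U p) * S (U p) + sinh r * sinh r) * U v - cosh r * sinh r * W v))
     (inverse \<kappa> * (cosh r * sinh r * W v - (S (U p) * S (U p) + sinh r * sinh r) * U v)))) (at p)"
  unfolding helicoid_map_def[abs_def]
proof (rule has_derivative_eq_rhs, rule has_derivative_cylindrical)
  let ?s = "S (U p)" and ?c = "C (U p)" and ?d = "D (U p)" and ?n = "\<nu> (U p)"
  show "(\<Theta> has_derivative (\<lambda>v. \<kappa> * W v - \<kappa> * cosh r * sinh r * ?n * ?n * U v)) (at p)"
    by (rule Theta_deriv)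
  show "((\<lambda>p. - P1 (U p)) has_derivative (\<lambda>v. - (- (cosh r * sinh r * ?s * ?c * (?n * ?n * ?n)) * U v))) (at p)"
    by (intro has_derivative_minus compose_U_deriv P1_deriv)
  show "((\<lambda>p. - P2 (U p)) has_derivative (\<lambda>v. - (inverse \<kappa> * sqrt m * ?d * (?n * ?n * ?n) *
    ((?s * ?s + sinh r * sinh r) * (?c * ?c - ?s * ?s) - ?s * ?s * (?c * ?c)) * U v))) (at p)"
    by (intro has_derivative_minus compose_U_deriv P2_deriv)
  show "((\<lambda>p. inverse \<kappa> * (cosh r * sinh r) * W p - helicoid_zeta m r (U p)) has_derivative
      (\<lambda>v. inverse \<kappa> * (cosh r * sinh r) * W v - inverse \<kappa> * (?s * ?s + sinh r * sinh r) * U v)) (at p)"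
    by (intro has_derivative_diff has_derivative_mult_right W_deriv compose_U_deriv helicoid_zeta_deriv)
  have 1: "- (- (cosh r * sinh r * ?s * ?c * (?n * ?n * ?n)) * U v)
      - - P2 (U p) * (\<kappa> * W v - \<kappa> * cosh r * sinh r * ?n * ?n * U v) = ?s * ?c * ?n * W v" for v
    unfolding P2_def using rel_inverse(1) by algebra
  have 2: "- (inverse \<kappa> * sqrt m * ?d * (?n * ?n * ?n) *
    ((?s * ?s + sinh r * sinh r) * (?c * ?c - ?s * ?s) - ?s * ?s * (?c * ?c)) * U v)
     + - P1 (U p) * (\<kappa> * W v - \<kappa> * cosh r * sinh r * ?n * ?n * U v)
     = sqrt m * inverse \<kappa> * ?d * ?n * ((?s * ?s + sinh r * sinh r) * U v - cosh r * sinh r * W v)" for v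
    unfolding P1_def using rel_inverse(1) rel_cosh rel_SC[of "U p"] rel_nu[of "U p"] by algebra
  have 3: "inverse \<kappa> * (cosh r * sinh r) * W v - inverse \<kappa> * (?s * ?s + sinh r * sinh r) * U v
     = inverse \<kappa> * (cosh r * sinh r * W v - (?s * ?s + sinh r * sinh r) * U v)" for v by algebra
  show "(\<lambda>v. cylindrical (\<Theta> p)
      (- (- (cosh r * sinh r * ?s * ?c * (?n * ?n * ?n)) * U v)
        - - P2 (U p) * (\<kappa> * W v - \<kappa> * cosh r * sinh r * ?n * ?n * U v))
      (- (inverse \<kappa> * sqrt m * ?d * (?n * ?n * ?n) *
         ((?s * ?s + sinh r * sinh r) * (?c * ?c - ?s * ?s) - ?s * ?s * (?c * ?c)) * U v)
        + - P1 (U p) * (\<kappa> * W v - \<kappa> * cosh r * sinh r * ?n * ?n * U v))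
      (inverse \<kappa> * (cosh r * sinh r) * W v - inverse \<kappa> * (?s * ?s + sinh r * sinh r) * U v))
    = (\<lambda>v. cylindrical (\<Theta> p) (?s * ?c * ?n * W v)
       (sqrt m * inverse \<kappa> * ?d * ?n * ((?s * ?s + sinh r * sinh r) * U v - cosh r * sinh r * W v))
       (inverse \<kappa> * (cosh r * sinh r * W v - (?s * ?s + sinh r * sinh r) * U v)))"
    unfolding 1 2 3 ..
qed

lemma frame3_deriv:
  "(frame3 has_derivative (\<lambda>v. cylindrical (\<Theta> p)
     ((S (U p) * S (U p) + sinh r * sinh r) * \<nu> (U p) * W v - cosh r * sinh r * \<nu> (U p) * U v)
     (- (sqrt m * inverse \<kappa> * (S (U p) * C (U p) * D (U p) * \<nu> (U p))) * U v)
     (inverse \<kappa> * (S (U p) * C (U p)) * U v))) (at p)"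
  unfolding frame3_def[abs_def]
proof (rule has_derivative_eq_rhs, rule has_derivative_cylindrical)
  let ?s = "S (U p)" and ?c = "C (U p)" and ?d = "D (U p)" and ?n = "\<nu> (U p)"
  show "(\<Theta> has_derivative (\<lambda>v. \<kappa> * W v - \<kappa> * cosh r * sinh r * ?n * ?n * U v)) (at p)"
    by (rule Theta_deriv)
  show "((\<lambda>p. 0) has_derivative (\<lambda>v. 0)) (at p)" by (rule has_derivative_const)
  let ?b' = "- inverse \<kappa> * (((sqrt m * ?c * ?d) * ?s + (sqrt m * ?c * ?d) * ?s + 0) * ?n
      + (- (?n * ?n * ?n * (sqrt m * ?s * ?c * ?d))) * (?s * ?s + sinh r * sinh r))"
  show "((\<lambda>p. - inverse \<kappa> * ((S (U p) * S (U p) + sinh r * sinh r) * \<nu> (U p))) has_derivative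
      (\<lambda>v. ?b' * U v)) (at p)"
    by (rule compose_U_deriv[where g = "\<lambda>u. - inverse \<kappa> * ((S u * S u + sinh r * sinh r) * \<nu> u)"])
      (intro DERIV_cmult DERIV_mult DERIV_add S_deriv nu_deriv DERIV_const)
  let ?c' = "- (sqrt m * inverse \<kappa>) * (- (?s * ?c / sqrt m))"
  show "((\<lambda>p. - (sqrt m * inverse \<kappa>) * D (U p)) has_derivative (\<lambda>v. ?c' * U v)) (at p)"
    by (rule compose_U_deriv[where g = "\<lambda>u. - (sqrt m * inverse \<kappa>) * D u"]) (intro DERIV_cmult D_deriv)
  have 1: "0 - (- inverse \<kappa> * ((?s * ?s + sinh r * sinh r) * ?n)) *
      (\<kappa> * W v - \<kappa> * cosh r * sinh r * ?n * ?n * U v)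
    = (?s * ?s + sinh r * sinh r) * ?n * W v - cosh r * sinh r * ?n * U v" for v
    using rel_inverse(1) rel_nu[of "U p"] by algebra
  have 2: "?b' * U v + 0 * (\<kappa> * W v - \<kappa> * cosh r * sinh r * ?n * ?n * U v)
    = - (sqrt m * inverse \<kappa> * (?s * ?c * ?d * ?n)) * U v" for v
    using rel_nu[of "U p"] by algebra
  have 3: "?c' * U v = inverse \<kappa> * (?s * ?c) * U v" for v
    using m by simp
  show "(\<lambda>v. cylindrical (\<Theta> p)
      (0 - (- inverse \<kappa> * ((?s * ?s + sinh r * sinh r) * ?n)) *
         (\<kappa> * W v - \<kappa> * cosh r * sinh r * ?n * ?n * U v))
      (?b' * U v + 0 * (\<kappa> * W v - \<kappa> * cosh r * sinh r * ?n * ?n * U v))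
      (?c' * U v))
    = (\<lambda>v. cylindrical (\<Theta> p)
     ((?s * ?s + sinh r * sinh r) * ?n * W v - cosh r * sinh r * ?n * U v)
     (- (sqrt m * inverse \<kappa> * (?s * ?c * ?d * ?n)) * U v)
     (inverse \<kappa> * (?s * ?c) * U v))"
    unfolding 1 2 3 ..
qed

lemma frame_orthonormal: "oriented_orthonormal (frame1 p) (frame2 p) (frame3 p)"
  unfolding frame1_def frame2_def frame3_def
  by (rule oriented_orthonormal_cylindrical;
      insert rel_SC[of "U p"] rel_D[of "U p"] rel_nu[of "U p"] rel_cosh rel_kappa rel_sqrt rel_inverse(1); algebra)

lemma helicoid_angle_eq: "helicoid_angle (1 / m) r p = - 2 * \<alpha> (U p)"
  unfolding helicoid_angle_def \<alpha>_def U_def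
  by (simp add: case_prod_unfold real_sqrt_divide algebra_simps)

lemma cos_half_angle: "cos (helicoid_angle (1 / m) r p / 2) = C (U p)"
  by (simp add: helicoid_angle_eq C_def)

lemma sin_half_angle: "sin (helicoid_angle (1 / m) r p / 2) = - S (U p)"
  by (simp add: helicoid_angle_eq S_def)

lemma helicoid_map_partial_s: "frechet_derivative helicoid_map (at p) (1, 0) = C (U p) *\<^sub>R frame1 p"
proof -
  have UW: "U (1, 0) = sinh r" "W (1, 0) = cosh r" by (simp_all add: U_def W_def)
  show ?thesis
    unfolding frechet_derivative_at[OF helicoid_map_deriv, symmetric] frame1_def scaleR_cylindrical UW
    by (rule cylindrical_cong, algebra)
      (insert rel_SC[of "U p"] rel_cosh, algebra+)
qed

lemma helicoid_map_partial_t: "frechet_derivative helicoid_map (at p) (0, 1) = - S (U p) *\<^sub>R frame2 p"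
proof -
  have UW: "U (0, 1) = cosh r" "W (0, 1) = sinh r" by (simp_all add: U_def W_def)
  show ?thesis
    unfolding frechet_derivative_at[OF helicoid_map_deriv, symmetric] frame2_def scaleR_cylindrical UW
    by (rule cylindrical_cong; algebra)
qed

text \<open>In the coordinates \<open>(U, W)\<close> the form is \<open>S C (dW\<^sup>2 - dU\<^sup>2)\<close> up to sign; the mixed term vanishes
because \<open>\<kappa>\<^sup>2 = m D\<^sup>2 + S\<^sup>2 + sinh\<^sup>2 r\<close>.\<close>

lemma second_fundamental_form:
  "- inner (frechet_derivative helicoid_map (at p) (a, b)) (frechet_derivative frame3 (at p) (a, b))
     = C (U p) * - S (U p) * (a\<^sup>2 - b\<^sup>2)"
  unfolding frechet_derivative_at[OF helicoid_map_deriv, symmetric] frechet_derivative_at[OF frame3_deriv, symmetric]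
    inner_cylindrical U_def[of "(a, b)"] W_def[of "(a, b)"] fst_conv snd_conv
  using rel_SC[of "U p"] rel_D[of "U p"] rel_nu[of "U p"] rel_cosh rel_kappa rel_sqrt rel_inverse(1) by algebra

text \<open>Sums and products of these functions make up the angle function and the coordinates of the
map and of its frame, and the derivatives of the functions are again such sums and products. The integral \<open>\<psi>\<close> is absent: it
occurs only inside \<open>sin \<Theta>\<close> and \<open>cos \<Theta>\<close>.\<close>

definition generators :: "(real \<times> real \<Rightarrow> real) set" where
  "generators = {\<lambda>p. \<alpha> (U p), \<lambda>p. S (U p), \<lambda>p. C (U p), \<lambda>p. D (U p), \<lambda>p. \<nu> (U p),
     \<lambda>p. helicoid_zeta m r (U p), W, \<lambda>p. sin (\<Theta> p), \<lambda>p. cos (\<Theta> p)}"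

lemma generators_mem:
  "(\<lambda>p. \<alpha> (U p)) \<in> algebra_generated generators"
  "(\<lambda>p. S (U p)) \<in> algebra_generated generators"
  "(\<lambda>p. C (U p)) \<in> algebra_generated generators"
  "(\<lambda>p. D (U p)) \<in> algebra_generated generators"
  "(\<lambda>p. \<nu> (U p)) \<in> algebra_generated generators"
  "(\<lambda>p. helicoid_zeta m r (U p)) \<in> algebra_generated generators"
  "(\<lambda>p. W p) \<in> algebra_generated generators"
  "(\<lambda>p. sin (\<Theta> p)) \<in> algebra_generated generators"
  "(\<lambda>p. cos (\<Theta> p)) \<in> algebra_generated generators"
  by (rule algebra_generated.base; simp add: generators_def)+

lemmas algebra_generated_rules = generators_mem algebra_generated.add algebra_generated.mult
  algebra_generated_diff algebra_generated_uminus algebra_generated.const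

lemma derivation_closed_generators: "derivation_closed generators"
  unfolding derivation_closed_def
proof
  have U: "\<exists>b'. (\<forall>p. ((\<lambda>p. g (U p)) has_derivative b' p) (at p)) \<and> (\<forall>v. (\<lambda>p. b' p v) \<in> algebra_generated generators)"
    if "\<And>u. (g has_real_derivative g' u) (at u)" "(\<lambda>p. g' (U p)) \<in> algebra_generated generators" for g g'
    using that by (intro exI[of _ "\<lambda>p v. g' (U p) * U v"])
      (auto intro!: compose_U_deriv algebra_generated.mult algebra_generated.const)
  let ?T = "\<lambda>p v. \<kappa> * W v - \<kappa> * cosh r * sinh r * \<nu> (U p) * \<nu> (U p) * U v"
  have T: "(\<lambda>p. ?T p v) \<in> algebra_generated generators" for v
    by (intro algebra_generated_rules)
  fix b assume "b \<in> generators"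
  then consider "b = (\<lambda>p. \<alpha> (U p))" | "b = (\<lambda>p. S (U p))" | "b = (\<lambda>p. C (U p))" | "b = (\<lambda>p. D (U p))"
    | "b = (\<lambda>p. \<nu> (U p))" | "b = (\<lambda>p. helicoid_zeta m r (U p))" | "b = W"
    | "b = (\<lambda>p. sin (\<Theta> p))" | "b = (\<lambda>p. cos (\<Theta> p))"
    unfolding generators_def by blast
  then show "\<exists>b'. (\<forall>p. (b has_derivative b' p) (at p)) \<and> (\<forall>v. (\<lambda>p. b' p v) \<in> algebra_generated generators)"
  proof cases
    case 1 show ?thesis unfolding 1 by (rule U[OF alpha_deriv]) (intro algebra_generated_rules)
  next
    case 2 show ?thesis unfolding 2 by (rule U[OF S_deriv]) (intro algebra_generated_rules)
  next
    case 3 show ?thesis unfolding 3 by (rule U[OF C_deriv]) (intro algebra_generated_rules)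
  next
    case 4 show ?thesis unfolding 4
      by (rule U[OF D_deriv], unfold divide_inverse) (intro algebra_generated_rules)
  next
    case 5 show ?thesis unfolding 5 by (rule U[OF nu_deriv]) (intro algebra_generated_rules)
  next
    case 6 show ?thesis unfolding 6 by (rule U[OF helicoid_zeta_deriv]) (intro algebra_generated_rules)
  next
    case 7 show ?thesis unfolding 7
      by (intro exI[of _ "\<lambda>p. W"] conjI allI W_deriv algebra_generated.const)
  next
    case 8
    have "((\<lambda>p. sin (\<Theta> p)) has_derivative (\<lambda>v. cos (\<Theta> p) * ?T p v)) (at p)" for p
      by (auto intro!: derivative_eq_intros Theta_deriv)
    moreover have "(\<lambda>p. cos (\<Theta> p) * ?T p v) \<in> algebra_generated generators" for v
      by (intro algebra_generated.mult generators_mem T)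
    ultimately show ?thesis unfolding 8 by (intro exI[of _ "\<lambda>p v. cos (\<Theta> p) * ?T p v"]) simp
  next
    case 9
    have "((\<lambda>p. cos (\<Theta> p)) has_derivative (\<lambda>v. - (sin (\<Theta> p) * ?T p v))) (at p)" for p
      by (auto intro!: derivative_eq_intros Theta_deriv)
    moreover have "(\<lambda>p. - (sin (\<Theta> p) * ?T p v)) \<in> algebra_generated generators" for v
      by (intro algebra_generated_uminus algebra_generated.mult generators_mem T)
    ultimately show ?thesis unfolding 9 by (intro exI[of _ "\<lambda>p v. - (sin (\<Theta> p) * ?T p v)"]) simp
  qed
qed

lemma smooth_angle: "smooth (helicoid_angle (1 / m) r)"
proof -
  have "smooth (\<lambda>p. - 2 * \<alpha> (U p))"
    by (rule smooth_algebra_generated[OF derivation_closed_generators]) (intro algebra_generated_rules)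
  then show ?thesis unfolding helicoid_angle_eq[abs_def, symmetric] .
qed

lemma smooth_frame: "smooth helicoid_map" "smooth frame1" "smooth frame2" "smooth frame3"
  unfolding helicoid_map_def[abs_def] frame1_def[abs_def] frame2_def[abs_def] frame3_def[abs_def] cylindrical_def P1_def P2_def
  by (rule smooth_vector3_algebra_generated[OF derivation_closed_generators]; intro algebra_generated_rules)+

theorem is_pseudospherical_map_helicoid_map: "is_pseudospherical_map (helicoid_angle (1 / m) r) helicoid_map"
  unfolding is_pseudospherical_map_iff_frame pseudospherical_frame_def cos_half_angle sin_half_angle
  by (intro exI[of _ frame1] exI[of _ frame2] exI[of _ frame3] conjI allI impI smooth_frame frame_orthonormal
      helicoid_map_partial_s helicoid_map_partial_t second_fundamental_form)

text \<open>On the line in direction \<open>(0, 1)\<close> the angle has nonvanishing derivative. If \<open>sin \<phi>\<close> vanished near a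
point, so would its derivative \<open>cos \<phi> \<phi>\<^sub>t\<close> there, contradicting \<open>sin\<^sup>2 \<phi> + cos\<^sup>2 \<phi> = 1\<close>.\<close>

lemma regular_points_dense: "closure {p. \<forall>k::int. helicoid_angle (1 / m) r p \<noteq> of_int k * pi} = UNIV"
proof -
  let ?\<phi> = "helicoid_angle (1 / m) r"
  have "p \<in> closure {p. \<forall>k::int. ?\<phi> p \<noteq> of_int k * pi}" for p
    unfolding closure_approachable
  proof (intro allI impI, rule ccontr)
    fix e :: real assume e: "e > 0" and none: "\<not> (\<exists>y\<in>{p. \<forall>k::int. ?\<phi> p \<noteq> of_int k * pi}. dist y p < e)"
    then have zero: "sin (?\<phi> y) = 0" if "dist y p < e" for y
      unfolding sin_zero_iff_int2 using that none by blast
    define h where "h t = sin (- 2 * \<alpha> (U p + t * cosh r))" for t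
    have h0: "h t = 0" if "dist 0 t < e" for t
    proof -
      have "dist (fst p, snd p + t) p < e"
        using that by (cases p) (simp add: dist_Pair_Pair dist_real_def)
      from zero[OF this] show ?thesis
        by (simp add: h_def helicoid_angle_eq U_def algebra_simps)
    qed
    have "(h has_real_derivative cos (- 2 * \<alpha> (U p)) * (- 2 * (sqrt m * D (U p) * cosh r))) (at 0)"
      unfolding h_def[abs_def]
      by (auto intro!: derivative_eq_intros DERIV_chain2[OF alpha_deriv])
    moreover have "(h has_real_derivative 0) (at 0)"
      using DERIV_const[of 0 "at 0"] by (rule has_field_derivative_transform_within[OF _ e]) (use h0 in auto)
    ultimately have "cos (- 2 * \<alpha> (U p)) * (- 2 * (sqrt m * D (U p) * cosh r)) = 0"
      by (rule DERIV_unique)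
    then have "cos (- 2 * \<alpha> (U p)) = 0" using m D_pos[of "U p"] by simp
    moreover have "sin (- 2 * \<alpha> (U p)) = 0" using h0[of 0] e by (simp add: h_def)
    ultimately show False by (metis sin_cos_squared_add zero_neq_one add_0 power_zero_numeral)
  qed
  then show ?thesis by blast
qed

lemma real_analytic_at_elliptic: "real_analytic_at S u" "real_analytic_at C u" "real_analytic_at D u"
  "real_analytic_at \<nu> u" "real_analytic_at (helicoid_psi m r) u" "real_analytic_at (helicoid_zeta m r) u"
proof -
  have \<alpha>: "real_analytic_at \<alpha> u" for u
    unfolding \<alpha>_def[abs_def]
    by (rule real_analytic_at_compose[of "\<lambda>x. jacobi_am x (1 / m)" "\<lambda>u. sqrt m * u"])
      (intro real_analytic_at_jacobi_am modulus real_analytic_at_mult real_analytic_at_const real_analytic_at_ident)+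
  have S: "real_analytic_at S u" for u
    unfolding S_def[abs_def] by (rule real_analytic_at_compose[OF real_analytic_at_sin \<alpha>])
  have C: "real_analytic_at C u" for u
    unfolding C_def[abs_def] by (rule real_analytic_at_compose[OF real_analytic_at_cos \<alpha>])
  have D: "real_analytic_at D u" for u
  proof -
    have "real_analytic_at (\<lambda>u. sqrt (1 + (- (1 / m)) * (S u * S u))) u"
      using radicand_pos[of u]
      by (intro real_analytic_at_compose[of sqrt "\<lambda>u. 1 + (- (1 / m)) * (S u * S u)"] real_analytic_at_sqrt
          real_analytic_at_add real_analytic_at_mult real_analytic_at_const S) (simp add: power2_eq_square)
    then show ?thesis by (simp add: D_def[abs_def] power2_eq_square)
  qed
  have \<nu>: "real_analytic_at \<nu> u" for u
  proof -
    have "real_analytic_at (\<lambda>u. inverse (sqrt (S u * S u + sinh r * sinh r))) u"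
      using N_pos[of u]
      by (intro real_analytic_at_compose[of inverse "\<lambda>u. sqrt (S u * S u + sinh r * sinh r)"]
          real_analytic_at_compose[of sqrt "\<lambda>u. S u * S u + sinh r * sinh r"]
          real_analytic_at_inverse real_analytic_at_sqrt
          real_analytic_at_add real_analytic_at_mult real_analytic_at_const S)
        (auto simp: N_def power2_eq_square)
    then show ?thesis by (simp add: \<nu>_def[abs_def] N_def power2_eq_square inverse_eq_divide)
  qed
  show "real_analytic_at S u" "real_analytic_at C u" "real_analytic_at D u" "real_analytic_at \<nu> u"
    by (rule S C D \<nu>)+
  show "real_analytic_at (helicoid_psi m r) u"
    by (rule real_analytic_at_primitive[OF _ helicoid_psi_deriv])
      (intro real_analytic_at_uminus real_analytic_at_mult real_analytic_at_const \<nu>)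
  show "real_analytic_at (helicoid_zeta m r) u"
    by (rule real_analytic_at_primitive[OF _ helicoid_zeta_deriv])
      (intro real_analytic_at_add real_analytic_at_mult real_analytic_at_const S)
qed

lemma real_analytic_at_profile: "real_analytic_at (helicoid_x m r) u" "real_analytic_at (helicoid_y m r) u"
proof -
  have P: "real_analytic_at P1 u" "real_analytic_at P2 u"
    unfolding P1_def[abs_def] P2_def[abs_def]
    by (intro real_analytic_at_mult real_analytic_at_const real_analytic_at_elliptic)+
  have trig: "real_analytic_at (\<lambda>u. sin (helicoid_psi m r u)) u" "real_analytic_at (\<lambda>u. cos (helicoid_psi m r u)) u"
    by (rule real_analytic_at_compose[of sin] real_analytic_at_compose[of cos];
        intro real_analytic_at_sin real_analytic_at_cos real_analytic_at_elliptic)+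
  show "real_analytic_at (helicoid_x m r) u"
    unfolding helicoid_x_eq[abs_def] diff_conv_add_uminus
    by (intro real_analytic_at_add real_analytic_at_uminus real_analytic_at_mult P trig)
  show "real_analytic_at (helicoid_y m r) u"
    unfolding helicoid_y_eq[abs_def]
    by (intro real_analytic_at_add real_analytic_at_mult P trig)
qed

lemma real_analytic_helicoid_param: "real_analytic (helicoid_param m r)"
proof -
  have lin: "real_analytic_at (\<lambda>v. 2 * pi * v) v" for v
    by (intro real_analytic_at_mult real_analytic_at_const real_analytic_at_ident)
  have trig: "real_analytic_at (\<lambda>v. sin (2 * pi * v)) v" "real_analytic_at (\<lambda>v. cos (2 * pi * v)) v" for v
    by (rule real_analytic_at_compose[of sin] real_analytic_at_compose[of cos];
        intro real_analytic_at_sin real_analytic_at_cos lin)+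
  have eq: "helicoid_param m r = (\<lambda>p. vector
     [(\<lambda>(u, v). helicoid_x m r u * cos (2 * pi * v)) p + (\<lambda>(u, v). (- helicoid_y m r u) * sin (2 * pi * v)) p,
      (\<lambda>(u, v). helicoid_x m r u * sin (2 * pi * v)) p + (\<lambda>(u, v). helicoid_y m r u * cos (2 * pi * v)) p,
      (\<lambda>(u, v). helicoid_zeta m r u * 1) p + (\<lambda>(u, v). helicoid_rho m r * v) p])"
    by (simp add: fun_eq_iff helicoid_param_def mult.commute)
  show ?thesis
    unfolding eq
    by (intro real_analytic_vector3 real_analytic_add real_analytic_product real_analytic_at_uminus
        real_analytic_at_const real_analytic_at_ident trig real_analytic_at_profile real_analytic_at_elliptic)
qed

text \<open>The selected representative of the pseudospherical map and the explicit one differ by a proper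
rigid motion, which commutes with the point reflection \<open>x \<mapsto> - x\<close> up to the sign of the
translation.\<close>

lemma global_parametrization_helicoid_param:
  "global_parametrization (helicoid_param m r) (uminus ` pseudospherical_helicoid (1 / m) r)"
proof -
  let ?\<phi> = "helicoid_angle (1 / m) r"
  have "is_pseudospherical_map ?\<phi> (pseudospherical_map ?\<phi>)"
    unfolding pseudospherical_map_def by (rule someI[of _ helicoid_map]) (rule is_pseudospherical_map_helicoid_map)
  then obtain A b where A: "rotation_matrix A" "\<And>p. helicoid_map p = A *v pseudospherical_map ?\<phi> p + b"
    using pseudospherical_map_unique[OF _ is_pseudospherical_map_helicoid_map smooth_angle regular_points_dense] by blast
  have "range (helicoid_param m r) = uminus ` range helicoid_map"
    unfolding range_helicoid_map image_image by simp
  also have "\<dots> = (\<lambda>x. A *v x + (- b)) ` uminus ` range (pseudospherical_map ?\<phi>)"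
    unfolding image_image A(2)
    by (simp add: linear_neg[OF matrix_vector_mul_linear])
  finally show ?thesis
    unfolding global_parametrization_def rigidly_congruent_def pseudospherical_helicoid_def
    using A(1) by blast
qed

end

theorem theorem7:
  fixes \<mu> r m :: real
  assumes "0 < \<mu>" and "\<mu> < 1" and "0 < r" and "m = inverse \<mu>"
  shows "real_analytic (helicoid_param m r) \<and>
         global_parametrization (helicoid_param m r) (uminus ` pseudospherical_helicoid \<mu> r)"
proof -
  have \<mu>: "\<mu> = 1 / m" using assms by (simp add: divide_inverse)
  interpret helicoid_parameters m r
    using assms by unfold_locales (auto simp: one_less_inverse)
  show ?thesis
    unfolding \<mu> using real_analytic_helicoid_param global_parametrization_helicoid_param by blast
qed

end
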